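(* Let $\mathbb{X}$ and $\mathbb{Y}$ be standard Borel spaces with $\mathbb{Y}$ compact, and let $\zeta\in\mathcal{P}(\mathbb{X})$ be fixed. Let $\mu$ and $\nu$ be information structures, i.e. probability measures on $\mathbb{X}\times\mathbb{Y}$ with $\mathbb{X}$-marginal $\zeta$, with measurement channels $Q_\mu,Q_\nu$ (stochastic kernels from $\mathbb{X}$ to $\mathbb{Y}$) so that $\mu(dx,dy)=\zeta(dx)Q_\mu(dy|x)$ and $\nu(dx,dy)=\zeta(dx)Q_\nu(dy|x)$. Assume the measurement is absolutely continuous in the following sense: for each of these channels $Q$ there exist a function $f$ and a reference probability measure $\bar Q$ on $\mathbb{Y}$ such that $Q(S|x)=\int_S f(y,x)\,\bar Q(dy)$ for all Borel $S\subset\mathbb{Y}$. If $\mu$ is more informative than $\nu$ over all single-player decision problems $(c,\mathbb{U})$ with compact standard Borel action space $\mathbb{U}$ and bounded (measurable) cost function $c:\mathbb{X}\times\mathbb{U}\to\mathbb{R}$ that is continuous in $u$ for every $x$, then $\nu$ is a garbling of $\mu$: there exists a stochastic kernel $Q'$ from $\mathbb{Y}$ to $\mathbb{Y}$ such that $$Q_\nu(B|x)=\int_{\mathbb{Y}}Q'(B|y)\,Q_\mu(dy|x),\qquad B\in\mathcal{B}(\mathbb{Y}),\ \text{for }\zeta\text{-a.e. }x\in\mathbb{X}.$$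
   Context: A standard Borel space is a Borel subset of a complete separable metric space; $\mathcal{P}(\cdot)$ denotes Borel probability measures. A single-player decision problem is a pair $(c,\mathbb{U})$ of an action space $\mathbb{U}$ and a cost function $c:\mathbb{X}\times\mathbb{U}\to\mathbb{R}$; the player observes $y$ and minimizes $E_\zeta^{\mu,\gamma}[c(x,u)]$, the expectation of $c(x,u)$ when $(x,y)\sim\mu$ and $u$ is chosen by the policy $\gamma$ from the observation $y$. The set $\Gamma$ of admissible policies consists of measurable maps $\gamma:\mathbb{Y}\to\mathbb{U}$, where randomization by an independent noise variable, $u=\gamma(y,\omega)$, may also be allowed. An information structure $\mu$ is more informative than $\nu$ over a class of single-player decision problems if $$\inf_{\gamma\in\Gamma}E_\zeta^{\nu,\gamma}[c(x,u)]\ \ge\ \inf_{\gamma\in\Gamma}E_\zeta^{\mu,\gamma}[c(x,u)]$$ for every $(c,\mathbb{U})$ in the class. *)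

theory Defs
  imports "HOL-Probability.Probability"
begin

text \<open>A standard Borel space is a Borel set \<open>S\<close> in a Polish type, with the
  subspace topology and the following \<open>\<sigma>\<close>-algebra.\<close>

abbreviation borel_on :: "'a::topological_space set \<Rightarrow> 'a measure" where
  "borel_on S \<equiv> restrict_space borel S"


subsection \<open>Information structures and channels\<close>

definition information_structure ::
  "'x::polish_space set \<Rightarrow> 'y::polish_space set \<Rightarrow> 'x measure \<Rightarrow> ('x \<times> 'y) measure \<Rightarrow> bool" where
  "information_structure X Y \<zeta> \<mu> \<longleftrightarrow>
     prob_space \<mu> \<and>
     sets \<mu> = sets (borel_on X \<Otimes>\<^sub>M borel_on Y) \<and>
     distr \<mu> (borel_on X) fst = \<zeta>"

definition stochastic_kernel ::
  "'a::polish_space set \<Rightarrow> 'b::polish_space set \<Rightarrow> ('a \<Rightarrow> 'b measure) \<Rightarrow> bool" where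
  "stochastic_kernel A B Q \<longleftrightarrow> Q \<in> borel_on A \<rightarrow>\<^sub>M prob_algebra (borel_on B)"

text \<open>\<open>\<mu>(dx,dy) = \<zeta>(dx) Q(dy|x)\<close>, evaluated on measurable sets.\<close>

definition measurement_channel ::
  "'x::polish_space set \<Rightarrow> 'y::polish_space set \<Rightarrow> 'x measure \<Rightarrow> ('x \<times> 'y) measure
    \<Rightarrow> ('x \<Rightarrow> 'y measure) \<Rightarrow> bool" where
  "measurement_channel X Y \<zeta> \<mu> Q \<longleftrightarrow>
     stochastic_kernel X Y Q \<and>
     (\<forall>C \<in> sets (borel_on X \<Otimes>\<^sub>M borel_on Y).
        emeasure \<mu> C = (\<integral>\<^sup>+ x. emeasure (Q x) {y. (x, y) \<in> C} \<partial>\<zeta>))"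

text \<open>Only measurability in \<open>y\<close> (contained in integrability) is demanded of the density \<open>f\<close>.\<close>

definition absolutely_continuous_channel ::
  "'x::polish_space set \<Rightarrow> 'y::polish_space set \<Rightarrow> ('x \<Rightarrow> 'y measure) \<Rightarrow> bool" where
  "absolutely_continuous_channel X Y Q \<longleftrightarrow>
     (\<exists>(f :: 'y \<Rightarrow> 'x \<Rightarrow> real) Qbar.
        prob_space Qbar \<and> sets Qbar = sets (borel_on Y) \<and>
        (\<forall>x\<in>X. integrable Qbar (\<lambda>y. f y x) \<and>
           (\<forall>S \<in> sets (borel_on Y). measure (Q x) S = (LINT y:S|Qbar. f y x))))"

definition garbling ::
  "'x::polish_space set \<Rightarrow> 'y::polish_space set \<Rightarrow> 'x measure
    \<Rightarrow> ('x \<Rightarrow> 'y measure) \<Rightarrow> ('x \<Rightarrow> 'y measure) \<Rightarrow> bool" where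
  "garbling X Y \<zeta> Q\<nu> Q\<mu> \<longleftrightarrow>
     (\<exists>Q'. stochastic_kernel Y Y Q' \<and>
        (AE x in \<zeta>. \<forall>B \<in> sets (borel_on Y).
           measure (Q\<nu> x) B = (\<integral>y. measure (Q' y) B \<partial>Q\<mu> x)))"


subsection \<open>Decision problems\<close>

definition expected_cost ::
  "('x \<Rightarrow> 'u \<Rightarrow> real) \<Rightarrow> ('x \<times> 'y) measure \<Rightarrow> ('y \<Rightarrow> 'u) \<Rightarrow> real" where
  "expected_cost c \<mu> \<gamma> = (\<integral>(x, y). c x (\<gamma> y) \<partial>\<mu>)"

abbreviation (input) policies ::
  "'y::polish_space set \<Rightarrow> 'u::polish_space set \<Rightarrow> ('y \<Rightarrow> 'u) set" where
  "policies Y U \<equiv> borel_on Y \<rightarrow>\<^sub>M borel_on U"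

definition optimal_cost ::
  "'y::polish_space set \<Rightarrow> ('x \<Rightarrow> 'u::polish_space \<Rightarrow> real) \<Rightarrow> 'u set \<Rightarrow> ('x \<times> 'y) measure \<Rightarrow> real" where
  "optimal_cost Y c U \<mu> = (INF \<gamma> \<in> policies Y U. expected_cost c \<mu> \<gamma>)"

text \<open>Decision problems \<open>(c, U)\<close> with compact \<open>U\<close> (compact sets are Borel) and bounded
  measurable \<open>c\<close> that is continuous in the action.  Nonemptiness of \<open>U\<close> makes the real-valued
  infimum meaningful; for empty \<open>U\<close> there is no policy and both infima would be \<open>\<infinity>\<close>.\<close>

definition compact_continuous_problems ::
  "'x::polish_space set \<Rightarrow> (('x \<Rightarrow> 'u::polish_space \<Rightarrow> real) \<times> 'u set) set" where
  "compact_continuous_problems X =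
     {(c, U). compact U \<and> U \<noteq> {} \<and>
        case_prod c \<in> borel_measurable (borel_on X \<Otimes>\<^sub>M borel_on U) \<and>
        (\<exists>C. \<forall>x\<in>X. \<forall>u\<in>U. \<bar>c x u\<bar> \<le> C) \<and>
        (\<forall>x\<in>X. continuous_on U (c x))}"

definition more_informative_over ::
  "(('x \<Rightarrow> 'u::polish_space \<Rightarrow> real) \<times> 'u set) set
    \<Rightarrow> 'y::polish_space set \<Rightarrow> ('x \<times> 'y) measure \<Rightarrow> ('x \<times> 'y) measure \<Rightarrow> bool" where
  "more_informative_over D Y \<mu> \<nu> \<longleftrightarrow>
     (\<forall>(c, U) \<in> D. optimal_cost Y c U \<nu> \<ge> optimal_cost Y c U \<mu>)"


subsection \<open>All compact action spaces at once\<close>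

text \<open>A formula cannot quantify over all types of actions.  Every compact metrizable space is
  homeomorphic to a compact subset of \<open>\<real>\<^sup>\<nat>\<close>, so nothing is lost by taking the actions in the
  Polish type \<open>nat \<Rightarrow> real\<close>; the lemma \<open>more_informative_universal\<close> below proves this.\<close>

definition more_informative ::
  "'x::polish_space set \<Rightarrow> 'y::polish_space set \<Rightarrow> ('x \<times> 'y) measure \<Rightarrow> ('x \<times> 'y) measure \<Rightarrow> bool" where
  "more_informative X Y \<mu> \<nu> \<longleftrightarrow>
     more_informative_over
       (compact_continuous_problems X :: (('x \<Rightarrow> (nat \<Rightarrow> real) \<Rightarrow> real) \<times> (nat \<Rightarrow> real) set) set) Y \<mu> \<nu>"

lemma ex_continuous_injection:
  "\<exists>e :: 'u::polish_space \<Rightarrow> nat \<Rightarrow> real. continuous_on UNIV e \<and> inj e"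
proof -
  obtain D :: "'u set" where D: "countable D"
    "\<And>X. open X \<Longrightarrow> X \<noteq> {} \<Longrightarrow> \<exists>d\<in>D. d \<in> X"
    using countable_dense_exists by blast
  have ne: "D \<noteq> {}" using D(2)[of UNIV] by auto
  define e :: "'u \<Rightarrow> nat \<Rightarrow> real" where "e u n = dist u (from_nat_into D n)" for u n
  have "continuous_on UNIV e"
    unfolding e_def
    by (intro continuous_on_coordinatewise_then_product continuous_intros)
  moreover have "inj e"
  proof (rule injI, rule ccontr)
    fix u v assume eq: "e u = e v" and "u \<noteq> v"
    then obtain d where d: "d \<in> D" "d \<in> ball u (dist u v / 2)"
      using D(2)[of "ball u (dist u v / 2)"] by auto
    obtain n where n: "d = from_nat_into D n"
      using d(1) D(1) ne by (metis from_nat_into_surj)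
    have "dist u d = dist v d" using fun_cong[OF eq, of n] by (simp add: e_def n)
    then show False
      using d(2) dist_triangle2[of u v d] by simp
  qed
  ultimately show ?thesis by blast
qed

lemma optimal_cost_homeomorphism:
  assumes e: "e \<in> borel_on U \<rightarrow>\<^sub>M borel_on V" and g: "g \<in> borel_on V \<rightarrow>\<^sub>M borel_on U"
    and ge: "\<forall>u\<in>U. g (e u) = u" and sets: "sets \<mu> = sets (borel_on X \<Otimes>\<^sub>M borel_on Y)"
  shows "optimal_cost Y (\<lambda>x v. c x (g v)) V \<mu> = optimal_cost Y c U \<mu>"
proof -
  have sp: "space \<mu> = X \<times> Y"
    using sets_eq_imp_space_eq[OF sets] by (simp add: space_pair_measure space_restrict_space)
  have "expected_cost (\<lambda>x v. c x (g v)) \<mu> ` policies Y V = expected_cost c \<mu> ` policies Y U"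
  proof (intro equalityI subsetI)
    fix r assume "r \<in> expected_cost (\<lambda>x v. c x (g v)) \<mu> ` policies Y V"
    then obtain \<gamma> where "\<gamma> \<in> policies Y V" and r: "r = expected_cost (\<lambda>x v. c x (g v)) \<mu> \<gamma>" by blast
    then have "g \<circ> \<gamma> \<in> policies Y U" using g by (intro measurable_comp)
    moreover have "r = expected_cost c \<mu> (g \<circ> \<gamma>)" by (simp add: r expected_cost_def)
    ultimately show "r \<in> expected_cost c \<mu> ` policies Y U" by blast
  next
    fix r assume "r \<in> expected_cost c \<mu> ` policies Y U"
    then obtain \<gamma> where \<gamma>: "\<gamma> \<in> policies Y U" and r: "r = expected_cost c \<mu> \<gamma>" by blast
    then have "e \<circ> \<gamma> \<in> policies Y V" using e by (intro measurable_comp)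
    moreover have "r = expected_cost (\<lambda>x v. c x (g v)) \<mu> (e \<circ> \<gamma>)"
      unfolding r expected_cost_def
      using measurable_space[OF \<gamma>]
      by (intro Bochner_Integration.integral_cong)
         (auto simp: sp ge space_restrict_space)
    ultimately show "r \<in> expected_cost (\<lambda>x v. c x (g v)) \<mu> ` policies Y V" by blast
  qed
  then show ?thesis unfolding optimal_cost_def by simp
qed

lemma more_informative_universal:
  fixes X :: "'x::polish_space set" and Y :: "'y::polish_space set"
  assumes mi: "more_informative X Y \<mu> \<nu>"
    and sets: "sets \<mu> = sets (borel_on X \<Otimes>\<^sub>M borel_on Y)"
      "sets \<nu> = sets (borel_on X \<Otimes>\<^sub>M borel_on Y)"
  shows "more_informative_over
    (compact_continuous_problems X :: (('x \<Rightarrow> 'u::polish_space \<Rightarrow> real) \<times> 'u set) set) Y \<mu> \<nu>"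
  unfolding more_informative_over_def
proof safe
  fix c :: "'x \<Rightarrow> 'u \<Rightarrow> real" and U :: "'u set"
  assume "(c, U) \<in> compact_continuous_problems X"
  then have U: "compact U" "U \<noteq> {}"
    and c: "case_prod c \<in> borel_measurable (borel_on X \<Otimes>\<^sub>M borel_on U)"
      "\<exists>C. \<forall>x\<in>X. \<forall>u\<in>U. \<bar>c x u\<bar> \<le> C" "\<forall>x\<in>X. continuous_on U (c x)"
    by (auto simp: compact_continuous_problems_def)
  obtain e :: "'u \<Rightarrow> nat \<Rightarrow> real" where e: "continuous_on UNIV e" "inj e"
    using ex_continuous_injection by blast
  define V where "V = e ` U"
  have eU: "continuous_on U e" "inj_on e U"
    using e by (auto intro: continuous_on_subset inj_on_subset)
  then obtain g where hom: "homeomorphism U V e g"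
    using homeomorphism_compact[OF U(1)] V_def by blast
  have gV: "continuous_on V g" "g ` V = U" "\<forall>u\<in>U. g (e u) = u"
    using hom by (auto simp: homeomorphism_def)
  have me: "e \<in> borel_on U \<rightarrow>\<^sub>M borel_on V"
    using eU(1) by (intro measurable_restrict_space2 borel_measurable_continuous_on_restrict)
      (auto simp: V_def space_restrict_space)
  have mg: "g \<in> borel_on V \<rightarrow>\<^sub>M borel_on U"
    using gV by (intro measurable_restrict_space2 borel_measurable_continuous_on_restrict)
      (auto simp: space_restrict_space)
  have "(\<lambda>(x, v). (x, g v)) \<in> borel_on X \<Otimes>\<^sub>M borel_on V \<rightarrow>\<^sub>M borel_on X \<Otimes>\<^sub>M borel_on U"
    using mg by measurable
  from measurable_compose[OF this c(1)]
  have "(\<lambda>(x, v). c x (g v)) \<in> borel_measurable (borel_on X \<Otimes>\<^sub>M borel_on V)"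
    by (simp add: case_prod_beta')
  moreover have "compact V" "V \<noteq> {}"
    using U eU by (auto simp: V_def intro: compact_continuous_image)
  moreover have "\<exists>C. \<forall>x\<in>X. \<forall>v\<in>V. \<bar>c x (g v)\<bar> \<le> C"
    using c(2) gV(2) by blast
  moreover have "continuous_on V (\<lambda>v. c x (g v))" if "x \<in> X" for x
    using that c(3) gV by (metis continuous_on_compose2 order_refl)
  ultimately have "(\<lambda>x v. c x (g v), V) \<in> compact_continuous_problems X"
    by (simp add: compact_continuous_problems_def)
  then have "optimal_cost Y (\<lambda>x v. c x (g v)) V \<mu> \<le> optimal_cost Y (\<lambda>x v. c x (g v)) V \<nu>"
    using mi unfolding more_informative_def more_informative_over_def by blast
  then show "optimal_cost Y c U \<mu> \<le> optimal_cost Y c U \<nu>"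
    by (simp add: optimal_cost_homeomorphism[where e = e and g = g, OF me mg gV(3)] sets)
qed


subsection \<open>Randomized policies\<close>

text \<open>Randomizing by an independent noise \<open>\<omega>\<close> with law \<open>N\<close> does not lower the optimal cost, so
  it is immaterial whether the admissible policies include such randomized ones.\<close>

lemma optimal_cost_le_randomized:
  fixes X :: "'x::polish_space set" and Y :: "'y::polish_space set" and U :: "'u::polish_space set"
  assumes cU: "(c, U) \<in> compact_continuous_problems X"
    and \<mu>: "information_structure X Y \<zeta> \<mu>" and N: "prob_space N"
    and \<gamma>: "case_prod \<gamma> \<in> borel_on Y \<Otimes>\<^sub>M N \<rightarrow>\<^sub>M borel_on U"
  shows "optimal_cost Y c U \<mu> \<le> (\<integral>((x, y), \<omega>). c x (\<gamma> y \<omega>) \<partial>(\<mu> \<Otimes>\<^sub>M N))"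
proof -
  interpret \<mu>: prob_space \<mu> using \<mu> by (simp add: information_structure_def)
  interpret N: prob_space N by fact
  interpret P: pair_prob_space \<mu> N ..
  have sets: "sets \<mu> = sets (borel_on X \<Otimes>\<^sub>M borel_on Y)"
    using \<mu> by (simp add: information_structure_def)
  note [measurable_cong] = sets
  have sp: "space \<mu> = X \<times> Y"
    using sets_eq_imp_space_eq[OF sets] by (simp add: space_pair_measure space_restrict_space)
  have c[measurable]: "case_prod c \<in> borel_measurable (borel_on X \<Otimes>\<^sub>M borel_on U)"
    using cU by (simp add: compact_continuous_problems_def)
  obtain C where C: "\<And>x u. x \<in> X \<Longrightarrow> u \<in> U \<Longrightarrow> \<bar>c x u\<bar> \<le> C"
    using cU by (auto simp: compact_continuous_problems_def)
  have \<gamma>U: "\<gamma> y \<omega> \<in> U" if "y \<in> Y" "\<omega> \<in> space N" for y \<omega>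
    using measurable_space[OF \<gamma>, of "(y, \<omega>)"] that
    by (auto simp: space_pair_measure space_restrict_space)
  let ?F = "\<lambda>((x, y), \<omega>). c x (\<gamma> y \<omega>)"
  have "(\<lambda>z. (fst (fst z), case_prod \<gamma> (snd (fst z), snd z))) \<in> \<mu> \<Otimes>\<^sub>M N \<rightarrow>\<^sub>M borel_on X \<Otimes>\<^sub>M borel_on U"
    by (intro measurable_Pair measurable_compose[OF _ \<gamma>]) measurable
  from measurable_compose[OF this c] have F: "?F \<in> borel_measurable (\<mu> \<Otimes>\<^sub>M N)"
    by (simp add: case_prod_beta')
  have int: "integrable (\<mu> \<Otimes>\<^sub>M N) ?F"
    by (rule P.integrable_const_bound[OF _ F, of C])
       (auto intro!: AE_I2 C \<gamma>U simp: space_pair_measure sp)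
  have swap: "(\<integral>z. ?F z \<partial>(\<mu> \<Otimes>\<^sub>M N)) = (\<integral>\<omega>. (\<integral>p. ?F (p, \<omega>) \<partial>\<mu>) \<partial>N)"
    using P.integral_snd[of "\<lambda>p \<omega>. ?F (p, \<omega>)"] int by (simp add: case_prod_beta')
  have intN: "integrable N (\<lambda>\<omega>. \<integral>p. ?F (p, \<omega>) \<partial>\<mu>)"
    using P.integrable_snd[of "\<lambda>p \<omega>. ?F (p, \<omega>)"] int by (simp add: case_prod_beta')
  have bdd: "bdd_below (expected_cost c \<mu> ` policies Y U)"
  proof (rule bdd_belowI2)
    fix \<delta> assume d[measurable]: "\<delta> \<in> policies Y U"
    have "(\<lambda>(x, y). (x, \<delta> y)) \<in> \<mu> \<rightarrow>\<^sub>M borel_on X \<Otimes>\<^sub>M borel_on U" by measurable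
    from measurable_compose[OF this c] have m: "(\<lambda>(x, y). c x (\<delta> y)) \<in> borel_measurable \<mu>"
      by (simp add: case_prod_beta')
    have b: "\<bar>c x (\<delta> y)\<bar> \<le> C" if "(x, y) \<in> space \<mu>" for x y
      using that measurable_space[OF d, of y] by (intro C) (auto simp: sp space_restrict_space)
    have "integrable \<mu> (\<lambda>(x, y). c x (\<delta> y))"
      by (rule \<mu>.integrable_const_bound[OF _ m, of C]) (auto intro!: AE_I2 b)
    then have "(\<integral>p. - C \<partial>\<mu>) \<le> expected_cost c \<mu> \<delta>"
      unfolding expected_cost_def using b by (intro integral_mono) (auto simp: abs_le_iff, fastforce)
    then show "- C \<le> expected_cost c \<mu> \<delta>" by (simp add: \<mu>.prob_space)
  qed
  have "(\<integral>\<omega>. optimal_cost Y c U \<mu> \<partial>N) \<le> (\<integral>\<omega>. (\<integral>p. ?F (p, \<omega>) \<partial>\<mu>) \<partial>N)"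
  proof (rule integral_mono)
    fix \<omega> assume w: "\<omega> \<in> space N"
    have "(\<lambda>y. (y, \<omega>)) \<in> borel_on Y \<rightarrow>\<^sub>M borel_on Y \<Otimes>\<^sub>M N" using w by measurable
    from measurable_compose[OF this \<gamma>] have "(\<lambda>y. \<gamma> y \<omega>) \<in> policies Y U" by simp
    from cINF_lower[OF bdd this]
    show "optimal_cost Y c U \<mu> \<le> (\<integral>p. ?F (p, \<omega>) \<partial>\<mu>)"
      by (simp add: optimal_cost_def expected_cost_def case_prod_beta')
  qed (use intN in auto)
  then show ?thesis using swap by (simp add: N.prob_space case_prod_beta')
qed

end

theory Submission
  imports Defs
begin

text \<open>A Borel injection \<open>s : Y \<rightarrow> [0, 1]\<close> with a Borel left inverse reduces the theorem to actions in
  \<open>[0, 1]\<close>: a kernel \<open>K\<close> from \<open>Y\<close> to \<open>[0, 1]\<close> is wanted with \<open>s\<^sub>* Q\<^sub>\<nu>(\<cdot>|x) = \<integral> K(y) Q\<^sub>\<mu>(dy|x)\<close> for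
  almost every \<open>x\<close>.  Let \<open>e\<^sub>j\<close> be a sequence of continuous test functions that determines measures on
  the line.  The functions \<open>(x, j) \<mapsto> \<integral> \<integral> e\<^sub>j dK(y) Q\<^sub>\<mu>(dy|x)\<close> form a convex set as \<open>K\<close> varies.  If
  \<open>(x, j) \<mapsto> \<integral> e\<^sub>j(s(y)) Q\<^sub>\<nu>(dy|x)\<close> had positive \<open>L\<^sup>2\<close> distance from this set, the direction of a nearly
  shortest connecting vector would be a cost, continuous in the action, for which the policy \<open>s\<close> under
  \<open>\<nu>\<close> beats every policy under \<open>\<mu>\<close>.  So the distance is zero.  Among the approximating kernels, those of
  almost minimal \<open>L\<^sup>2\<close> norm converge almost everywhere along a subsequence, and Helly's theorem turns the
  pointwise limits into a kernel.\<close>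

subsection \<open>Convex sets in \<open>L\<^sup>2\<close>\<close>

lemma (in prob_space) integrable_bounded:
  fixes f :: "'a \<Rightarrow> real"
  assumes "f \<in> borel_measurable M" "\<And>x. x \<in> space M \<Longrightarrow> \<bar>f x\<bar> \<le> B"
  shows "integrable M f"
  using assms by (intro integrable_const_bound[of _ B]) auto

lemma (in prob_space) abs_integral_le:
  fixes f :: "'a \<Rightarrow> real"
  assumes "f \<in> borel_measurable M" "\<And>x. x \<in> space M \<Longrightarrow> \<bar>f x\<bar> \<le> B"
  shows "\<bar>\<integral>x. f x \<partial>M\<bar> \<le> B"
proof -
  have "\<bar>\<integral>x. f x \<partial>M\<bar> \<le> (\<integral>x. \<bar>f x\<bar> \<partial>M)" by (rule integral_abs_bound)
  also have "\<dots> \<le> (\<integral>x. B \<partial>M)"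
    using integrable_bounded[OF assms] assms(2) by (intro integral_mono) auto
  finally show ?thesis by (simp add: prob_space)
qed

lemma (in prob_space) integral_in_unit:
  fixes f :: "'a \<Rightarrow> real"
  assumes "f \<in> borel_measurable M" "\<And>x. x \<in> space M \<Longrightarrow> f x \<in> {0..1}"
  shows "(\<integral>x. f x \<partial>M) \<in> {0..1}"
proof -
  have "\<bar>f x\<bar> \<le> 1" if "x \<in> space M" for x using assms(2)[OF that] by simp
  from abs_integral_le[OF assms(1) this] show ?thesis
    using assms(2) by (auto simp: abs_le_iff intro!: integral_nonneg_AE)
qed

lemma unit_diff_bounds:
  fixes a b :: real
  assumes "a \<in> {0..1}" "b \<in> {0..1}"
  shows "\<bar>a - b\<bar> \<le> 1" "(a - b)\<^sup>2 \<le> 1"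
proof -
  show "\<bar>a - b\<bar> \<le> 1" using assms by (auto simp: abs_le_iff)
  then show "(a - b)\<^sup>2 \<le> 1" by (simp add: abs_square_le_1)
qed

lemma unit_mult_diff_bounds:
  fixes a b c d :: real
  assumes "a \<in> {0..1}" "b \<in> {0..1}" "c \<in> {0..1}" "d \<in> {0..1}"
  shows "\<bar>(a - b) * (c - d)\<bar> \<le> 1" "\<bar>(a - b) * c\<bar> \<le> 1"
  using unit_diff_bounds(1)[of a b] unit_diff_bounds(1)[of c d] assms
  by (auto simp: abs_mult intro!: mult_le_one)

text \<open>If \<open>d > 0\<close> were the infimum of \<open>\<parallel>\<phi> - f\<parallel>\<^sup>2\<close>, moving from a near-minimizer \<open>f\<close> a step of
  length \<open>d / 2\<close> towards the \<open>g\<close> supplied by the hypothesis would lead below \<open>d\<close>.\<close>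

lemma (in prob_space) L2_approx_convex:
  fixes \<phi> :: "'a \<Rightarrow> real"
  assumes \<phi>[measurable]: "\<phi> \<in> borel_measurable M" and \<phi>1: "\<And>x. x \<in> space M \<Longrightarrow> \<phi> x \<in> {0..1}"
    and T: "\<And>f. f \<in> T \<Longrightarrow> f \<in> borel_measurable M"
    and T1: "\<And>f x. f \<in> T \<Longrightarrow> x \<in> space M \<Longrightarrow> f x \<in> {0..1}"
    and "T \<noteq> {}"
    and convex: "\<And>f g t. f \<in> T \<Longrightarrow> g \<in> T \<Longrightarrow> t \<in> {0..1} \<Longrightarrow>
      \<exists>h\<in>T. \<forall>x\<in>space M. h x = (1 - t) * f x + t * g x"
    and dual: "\<And>f \<delta>. f \<in> T \<Longrightarrow> 0 < \<delta> \<Longrightarrow>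
      \<exists>g\<in>T. (\<integral>x. (\<phi> x - f x) * \<phi> x \<partial>M) \<le> (\<integral>x. (\<phi> x - f x) * g x \<partial>M) + \<delta>"
    and "0 < \<epsilon>"
  shows "\<exists>f\<in>T. (\<integral>x. (\<phi> x - f x)\<^sup>2 \<partial>M) < \<epsilon>"
proof -
  define D where "D f = (\<integral>x. (\<phi> x - f x)\<^sup>2 \<partial>M)" for f
  define d where "d = (INF f\<in>T. D f)"
  have bdd: "bdd_below (D ` T)" by (rule bdd_belowI2[of _ 0]) (simp add: D_def)
  have D1: "D f \<le> 1" if "f \<in> T" for f
  proof -
    note [measurable] = T[OF that]
    have "(\<integral>x. (\<phi> x - f x)\<^sup>2 \<partial>M) \<in> {0..1}"
      using unit_diff_bounds(2)[OF \<phi>1 T1[OF that]] by (intro integral_in_unit) auto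
    then show ?thesis by (simp add: D_def)
  qed
  obtain f0 where f0: "f0 \<in> T" using \<open>T \<noteq> {}\<close> by blast
  \<comment> \<open>This makes the step length \<open>d / 2\<close> used below an admissible convex
    weight.\<close>
  have "d \<le> 1" using cINF_lower[OF bdd f0] D1[OF f0] by (simp add: d_def)
  have "d \<le> 0"
  proof (rule ccontr)
    assume "\<not> d \<le> 0"
    then have d: "0 < d" by simp
    \<comment> \<open>The step of length \<open>t = d / 2\<close> will lower \<open>D\<close> by at
      least \<open>d\<^sup>2 / 4\<close>, so a slack of \<open>d\<^sup>2 / 8\<close> in the choice
      of \<open>f\<close> is small enough for a contradiction.\<close>
    have "d < d + d\<^sup>2 / 8" using d by simp
    then obtain f where f: "f \<in> T" "D f < d + d\<^sup>2 / 8"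
      unfolding d_def using \<open>T \<noteq> {}\<close> bdd by (subst (asm) cINF_less_iff) auto
    obtain g where g: "g \<in> T"
      "(\<integral>x. (\<phi> x - f x) * \<phi> x \<partial>M) \<le> (\<integral>x. (\<phi> x - f x) * g x \<partial>M) + d / 2"
      using dual[OF f(1), of "d / 2"] d by auto
    define t where "t = d / 2"
    have t: "t \<in> {0..1}" using d \<open>d \<le> 1\<close> by (simp add: t_def)
    note [measurable] = T[OF f(1)] T[OF g(1)]
    note b = unit_mult_diff_bounds[OF \<phi>1 T1[OF f(1)]]
    have i: "integrable M (\<lambda>x. (\<phi> x - f x) * \<phi> x)" "integrable M (\<lambda>x. (\<phi> x - f x) * f x)"
      "integrable M (\<lambda>x. (\<phi> x - f x) * g x)" "integrable M (\<lambda>x. (\<phi> x - f x)\<^sup>2)"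
      "integrable M (\<lambda>x. (g x - f x)\<^sup>2)"
      using b(2)[OF _ _ \<phi>1 \<phi>1] b(2)[OF _ _ T1[OF f(1)] \<phi>1] b(2)[OF _ _ T1[OF g(1)] \<phi>1]
        unit_diff_bounds(2)[OF \<phi>1 T1[OF f(1)]] unit_diff_bounds(2)[OF T1[OF g(1)] T1[OF f(1)]]
      by (auto intro!: integrable_bounded[of _ 1])
    obtain h where h: "h \<in> T" "\<And>x. x \<in> space M \<Longrightarrow> h x = (1 - t) * f x + t * g x"
      using convex[OF f(1) g(1) t] by blast
    \<comment> \<open>Splitting one factor \<open>\<phi> - f\<close> turns the choice of
      \<open>g\<close> into the bound \<open>D f - d / 2\<close> from below for the inner product of
      \<open>\<phi> - f\<close> with \<open>g - f\<close>, the linear term of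
      \<open>D h\<close>.\<close>
    have "D f = (\<integral>x. (\<phi> x - f x) * \<phi> x - (\<phi> x - f x) * f x \<partial>M)"
      unfolding D_def by (intro Bochner_Integration.integral_cong) (auto simp: power2_eq_square algebra_simps)
    then have Df: "D f = (\<integral>x. (\<phi> x - f x) * \<phi> x \<partial>M) - (\<integral>x. (\<phi> x - f x) * f x \<partial>M)"
      using i by simp
    have "D h = (\<integral>x. (\<phi> x - f x)\<^sup>2 - 2 * t * ((\<phi> x - f x) * g x - (\<phi> x - f x) * f x)
        + t\<^sup>2 * (g x - f x)\<^sup>2 \<partial>M)"
      unfolding D_def by (intro Bochner_Integration.integral_cong) (auto simp: h(2) power2_eq_square algebra_simps)
    also have "\<dots> = D f - 2 * t * ((\<integral>x. (\<phi> x - f x) * g x \<partial>M) - (\<integral>x. (\<phi> x - f x) * f x \<partial>M))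
        + t\<^sup>2 * (\<integral>x. (g x - f x)\<^sup>2 \<partial>M)"
      using i by (simp add: D_def)
    also have "\<dots> \<le> D f - 2 * t * (D f - d / 2) + t\<^sup>2 * 1"
    proof -
      have "(\<integral>x. (g x - f x)\<^sup>2 \<partial>M) \<in> {0..1}"
        using unit_diff_bounds(2)[OF T1[OF g(1)] T1[OF f(1)]] by (intro integral_in_unit) auto
      then show ?thesis using t g(2) Df
        by (intro add_mono diff_left_mono mult_left_mono) auto
    qed
    also have "\<dots> \<le> D f - 2 * t * (d - d / 2) + t\<^sup>2"
    proof -
      have "d \<le> D f" using cINF_lower[OF bdd f(1)] by (simp add: d_def)
      then have "t * d \<le> t * D f" using t by (intro mult_left_mono) auto
      then show ?thesis by (simp add: algebra_simps)
    qed
    also have "\<dots> < d"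
      using f(2) mult_pos_pos[OF d d] by (simp add: t_def power2_eq_square field_simps)
    also have "d \<le> D h"
      unfolding d_def by (intro cINF_lower bdd h)
    finally show False by simp
  qed
  then have "d < \<epsilon>" using \<open>0 < \<epsilon>\<close> by simp
  then show ?thesis
    unfolding d_def D_def[symmetric] using \<open>T \<noteq> {}\<close> bdd by (subst (asm) cINF_less_iff) auto
qed

text \<open>Elements of almost minimal \<open>L\<^sup>2\<close> norm form a Cauchy sequence by the parallelogram law.\<close>

lemma (in prob_space) AE_Cauchy_selection_convex:
  fixes C :: "nat \<Rightarrow> ('a \<Rightarrow> real) set"
  assumes C: "\<And>n f. f \<in> C n \<Longrightarrow> f \<in> borel_measurable M"
    and C1: "\<And>n f x. f \<in> C n \<Longrightarrow> x \<in> space M \<Longrightarrow> f x \<in> {0..1}"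
    and ne: "\<And>n. C n \<noteq> {}" and "decseq C"
    and convex: "\<And>n f g. f \<in> C n \<Longrightarrow> g \<in> C n \<Longrightarrow> (\<lambda>x. (f x + g x) / 2) \<in> C n"
  shows "\<exists>f. (\<forall>n. f n \<in> C n) \<and> (AE x in M. Cauchy (\<lambda>n. f n x))"
proof -
  define N where "N f = (\<integral>x. (f x)\<^sup>2 \<partial>M)" for f :: "'a \<Rightarrow> real"
  \<comment> \<open>Since the sets \<open>C n\<close> shrink, these infima increase; being at most
    1, they converge.\<close>
  define I where "I n = (INF f\<in>C n. N f)" for n
  have bdd: "bdd_below (N ` C n)" for n by (rule bdd_belowI2[of _ 0]) (simp add: N_def)
  have N1: "N f \<le> 1" if "f \<in> C n" for f n
  proof -
    note [measurable] = C[OF that]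
    have "(\<integral>x. (f x)\<^sup>2 \<partial>M) \<in> {0..1}"
      using C1[OF that] by (intro integral_in_unit) (auto simp: power_le_one)
    then show ?thesis by (simp add: N_def)
  qed
  have "I n \<le> 1" for n
    using ne[of n] cINF_lower[OF bdd] N1 unfolding I_def by fastforce
  moreover have "incseq I"
    unfolding I_def using \<open>decseq C\<close> ne bdd
    by (intro monoI cINF_superset_mono) (auto simp: decseq_def)
  ultimately obtain L where L: "I \<longlonglongrightarrow> L" "\<And>n. I n \<le> L"
    using incseq_convergent[of I 1] by auto
  define \<delta> where "\<delta> n = inverse (real (Suc n))" for n
  have \<delta>: "0 < \<delta> n" "\<delta> \<longlonglongrightarrow> 0" for n
    unfolding \<delta>_def by (simp, rule LIMSEQ_inverse_real_of_nat)
  have "\<exists>f\<in>C n. N f < I n + \<delta> n" for n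
    unfolding I_def using ne[of n] bdd \<delta>(1) by (subst cINF_less_iff[symmetric]) auto
  then obtain g where g: "\<And>n. g n \<in> C n" "\<And>n. N (g n) < I n + \<delta> n" by metis
  have gm[measurable]: "g n \<in> borel_measurable M" for n by (rule C[OF g(1)])
  \<comment> \<open>For \<open>n \<le> m\<close> both functions lie in \<open>C n\<close>, hence so
    does their midpoint, whose norm is at least \<open>I n\<close>. The parallelogram law then
    bounds the distance, with \<open>I m \<le> L\<close> for the later function.\<close>
  have par: "(\<integral>x. (g n x - g m x)\<^sup>2 \<partial>M) \<le> 2 * (L - I n) + 4 * \<delta> n" if "n \<le> m" for n m
  proof -
    have "g m \<in> C n" using g(1)[of m] \<open>decseq C\<close> that by (auto simp: decseq_def)
    then have mid: "I n \<le> N (\<lambda>x. (g n x + g m x) / 2)"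
      unfolding I_def by (intro cINF_lower bdd convex g(1))
    have i: "integrable M (\<lambda>x. (g n x)\<^sup>2)" "integrable M (\<lambda>x. (g m x)\<^sup>2)"
      "integrable M (\<lambda>x. ((g n x + g m x) / 2)\<^sup>2)"
      using C1[OF g(1)] C1[OF convex[OF g(1) \<open>g m \<in> C n\<close>]]
      by (auto intro!: integrable_bounded[of _ 1] simp: power_le_one)
    have "(\<integral>x. (g n x - g m x)\<^sup>2 \<partial>M)
        = (\<integral>x. 2 * (g n x)\<^sup>2 + 2 * (g m x)\<^sup>2 - 4 * ((g n x + g m x) / 2)\<^sup>2 \<partial>M)"
      by (intro Bochner_Integration.integral_cong) (auto simp: power2_eq_square field_simps)
    also have "\<dots> = 2 * N (g n) + 2 * N (g m) - 4 * N (\<lambda>x. (g n x + g m x) / 2)"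
      unfolding N_def using i by simp
    finally have "(\<integral>x. (g n x - g m x)\<^sup>2 \<partial>M)
      = 2 * N (g n) + 2 * N (g m) - 4 * N (\<lambda>x. (g n x + g m x) / 2)" .
    moreover note mid
    moreover have "\<delta> m \<le> \<delta> n" using that by (simp add: \<delta>_def)
    ultimately show ?thesis using g(2)[of n] g(2)[of m] L(2)[of m] by (smt (verit))
  qed
  have "(\<lambda>n. 2 * (L - I n) + 4 * \<delta> n) \<longlonglongrightarrow> 2 * (L - L) + 4 * 0"
    by (intro tendsto_intros L \<delta>(2))
  then have lim: "(\<lambda>n. 2 * (L - I n) + 4 * \<delta> n) \<longlonglongrightarrow> 0" by simp
  have "\<exists>K. \<forall>i\<ge>K. \<forall>j\<ge>K. (\<integral>x. norm (g i x - g j x) \<partial>M) < e" if "e > 0" for e :: real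
  proof -
    have "\<forall>\<^sub>F n in sequentially. 2 * (L - I n) + 4 * \<delta> n < e\<^sup>2"
      using that by (intro order_tendstoD(2)[OF lim]) simp
    then obtain K where K: "\<And>n. n \<ge> K \<Longrightarrow> 2 * (L - I n) + 4 * \<delta> n < e\<^sup>2"
      by (auto simp: eventually_sequentially)
    have le: "(\<integral>x. norm (g i x - g j x) \<partial>M) < e" if ij: "K \<le> i" "i \<le> j" for i j
    proof -
      have sq: "(\<integral>x. (g i x - g j x)\<^sup>2 \<partial>M) < e\<^sup>2" using par[OF ij(2)] K[OF ij(1)] by linarith
      have b: "integrable M (\<lambda>x. (g i x - g j x)\<^sup>2)" "integrable M (\<lambda>x. \<bar>g i x - g j x\<bar>)"
        using unit_diff_bounds[OF C1[OF g(1)] C1[OF g(1)]]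
        by (auto intro!: integrable_bounded[of _ 1])
      \<comment> \<open>Passing from L2 to L1: the inequality
        \<open>2 * a * e \<le> a\<^sup>2 + e\<^sup>2\<close> takes the place of
        Cauchy-Schwarz.\<close>
      have "(\<integral>x. \<bar>g i x - g j x\<bar> \<partial>M) \<le> (\<integral>x. ((g i x - g j x)\<^sup>2 / e + e) / 2 \<partial>M)"
      proof (rule integral_mono)
        fix x
        have "0 \<le> (\<bar>g i x - g j x\<bar> - e)\<^sup>2" by simp
        then show "\<bar>g i x - g j x\<bar> \<le> ((g i x - g j x)\<^sup>2 / e + e) / 2"
          using \<open>e > 0\<close> by (simp add: power2_diff field_simps power2_eq_square)
      qed (use b in auto)
      also have "\<dots> = ((\<integral>x. (g i x - g j x)\<^sup>2 \<partial>M) / e + e) / 2"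
        using b by (simp add: prob_space)
      also have "\<dots> < e"
        using sq \<open>e > 0\<close> by (simp add: field_simps power2_eq_square)
      finally show ?thesis by simp
    qed
    show ?thesis
    proof (intro exI[of _ K] allI impI)
      fix i j assume "i \<ge> K" "j \<ge> K"
      then show "(\<integral>x. norm (g i x - g j x) \<partial>M) < e"
        using le[of i j] le[of j i] by (cases "i \<le> j") (auto simp: abs_minus_commute)
    qed
  qed
  moreover have "integrable M (g n)" for n
    using C1[OF g(1)] by (intro integrable_bounded[of _ 1]) auto
  ultimately obtain r where r: "strict_mono r" "AE x in M. Cauchy (\<lambda>i. g (r i) x)"
    using cauchy_L1_AE_cauchy_subseq[of M g] by blast
  \<comment> \<open>The subsequence satisfies \<open>r n \<ge> n\<close>, so its n-th member still
    lies in the n-th set.\<close>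
  have "g (r n) \<in> C n" for n
    using g(1)[of "r n"] \<open>decseq C\<close> seq_suble[OF r(1), of n] by (auto simp: decseq_def)
  then show ?thesis using r(2) by (intro exI[of _ "\<lambda>n. g (r n)"]) auto
qed

subsection \<open>Kernels and measures on the line\<close>

lemma (in prob_space) integral_bind_bounded:
  fixes f :: "'b \<Rightarrow> real"
  assumes f[measurable]: "f \<in> borel_measurable N" and K: "K \<in> M \<rightarrow>\<^sub>M prob_algebra N"
    and B: "\<And>y. y \<in> space N \<Longrightarrow> \<bar>f y\<bar> \<le> B"
  shows "(\<integral>y. f y \<partial>(M \<bind> K)) = (\<integral>x. \<integral>y. f y \<partial>K x \<partial>M)"
proof -
  note K'[measurable] = measurable_prob_algebraD[OF K]
  have bind: "prob_space (M \<bind> K)" "sets (M \<bind> K) = sets N"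
    using prob_space_bind'[OF _ K] sets_bind'[OF _ K] prob_space_axioms by (auto simp: space_prob_algebra)
  have Kx: "prob_space (K x)" "sets (K x) = sets N" if "x \<in> space M" for x
    using measurable_space[OF K that] by (auto simp: space_prob_algebra)
  have B1: "\<bar>f y\<bar> \<le> B" if "y \<in> space L" "sets L = sets N" for y L
    using B that sets_eq_imp_space_eq by blast
  have fK: "integrable (K x) f" if "x \<in> space M" for x
    using prob_space.integrable_bounded[OF Kx(1)[OF that], of f B] B1 Kx[OF that] f
    by (metis measurable_cong_sets)
  have fb: "integrable (M \<bind> K) f"
    using prob_space.integrable_bounded[OF bind(1), of f B] B1 bind f
    by (metis measurable_cong_sets)
  have fKm[measurable]: "(\<lambda>x. \<integral>y. f y \<partial>K x) \<in> borel_measurable M"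
    using measurable_compose[OF K' integral_measurable_subprob_algebra[OF f]] .
  have fKB: "\<bar>\<integral>y. f y \<partial>K x\<bar> \<le> B" if x: "x \<in> space M" for x
    using prob_space.abs_integral_le[OF Kx(1)[OF x], of f B] B1[OF _ Kx(2)[OF x]] Kx(2)[OF x] f
    by (metis measurable_cong_sets)
  then have ifK: "integrable M (\<lambda>x. \<integral>y. f y \<partial>K x)" by (intro integrable_bounded[of _ B]) auto
  interpret bind: prob_space "M \<bind> K" by (rule bind)
  have f0: "0 \<le> f y + B" if "y \<in> space (M \<bind> K)" for y
    using B1[OF that bind(2)] by (simp add: abs_le_iff)
  have fK0: "0 \<le> (\<integral>y. f y \<partial>K x) + B" if "x \<in> space M" for x
    using fKB[OF that] by (simp add: abs_le_iff)
  \<comment> \<open>Adding the bound \<open>B\<close> makes the integrand nonnegative, so that the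
    bind rule for nonnegative integrals applies; the constant cancels at the end because all
    measures have mass 1.\<close>
  have "ennreal (\<integral>y. f y + B \<partial>(M \<bind> K)) = (\<integral>\<^sup>+y. ennreal (f y + B) \<partial>(M \<bind> K))"
    using fb f0 by (intro nn_integral_eq_integral[symmetric]) auto
  also have "\<dots> = (\<integral>\<^sup>+x. \<integral>\<^sup>+y. ennreal (f y + B) \<partial>K x \<partial>M)"
    by (rule nn_integral_bind[OF _ K']) simp
  also have "\<dots> = (\<integral>\<^sup>+x. ennreal ((\<integral>y. f y \<partial>K x) + B) \<partial>M)"
  proof (rule nn_integral_cong)
    fix x assume x: "x \<in> space M"
    interpret Kx: prob_space "K x" by (rule Kx[OF x])
    have "0 \<le> f y + B" if "y \<in> space (K x)" for y using B1[OF that Kx(2)[OF x]] by (simp add: abs_le_iff)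
    then have "(\<integral>\<^sup>+y. ennreal (f y + B) \<partial>K x) = ennreal (\<integral>y. f y + B \<partial>K x)"
      using fK[OF x] by (intro nn_integral_eq_integral) auto
    then show "(\<integral>\<^sup>+y. ennreal (f y + B) \<partial>K x) = ennreal ((\<integral>y. f y \<partial>K x) + B)"
      using fK[OF x] by (simp add: Kx.prob_space)
  qed
  also have "\<dots> = ennreal (\<integral>x. (\<integral>y. f y \<partial>K x) + B \<partial>M)"
    using ifK fK0 by (intro nn_integral_eq_integral) auto
  finally have "(\<integral>y. f y + B \<partial>(M \<bind> K)) = (\<integral>x. (\<integral>y. f y \<partial>K x) + B \<partial>M)"
    using f0 fK0 by (subst (asm) ennreal_inj) (auto intro!: integral_nonneg_AE)
  then show ?thesis using fb ifK by (simp add: prob_space bind.prob_space)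
qed

text \<open>Ramps descending from 1 to 0 between two rationals form a countable family. Squeezing
  both break points towards \<open>a\<close> from the right yields the indicator of the half-line,
  closed at \<open>a\<close>, so integrals of the family determine distribution functions.\<close>

lemma ex_ramp_sequence:
  "\<exists>e :: nat \<Rightarrow> real \<Rightarrow> real. (\<forall>j. continuous_on UNIV (e j)) \<and> (\<forall>j u. e j u \<in> {0..1}) \<and>
     (\<forall>a. \<exists>\<sigma>. \<forall>u. (\<lambda>k. e (\<sigma> k) u) \<longlonglongrightarrow> indicator {..a} u)"
proof -
  \<comment> \<open>For \<open>p < q\<close> the ramp is 1 up to \<open>p\<close> and 0 from
    \<open>q\<close> on. Pairs with \<open>p \<ge> q\<close> remain in the family; they too give
    continuous functions into the unit interval, the constant 0 when \<open>p = q\<close>.\<close>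
  define h :: "rat \<times> rat \<Rightarrow> real \<Rightarrow> real" where
    "h pq u = (case pq of (p, q) \<Rightarrow> max 0 (min 1 ((of_rat q - u) / (of_rat q - of_rat p))))" for pq u
  have hc: "continuous_on UNIV (h pq)" for pq
    unfolding h_def divide_inverse by (cases pq) (auto intro!: continuous_intros)
  have h1: "h pq u \<in> {0..1}" for pq u
    by (cases pq) (auto simp: h_def)
  have ex: "\<exists>pq. (\<forall>u\<le>a. h pq u = 1) \<and> (\<forall>u\<ge>a + \<delta>. h pq u = 0)" if "\<delta> > 0" for a \<delta> :: real
  proof -
    have "a < a + \<delta>" using that by simp
    then obtain p where p: "a < of_rat p" "of_rat p < a + \<delta>" using of_rat_dense by blast
    obtain q where q: "of_rat p < (of_rat q :: real)" "of_rat q < a + \<delta>" using of_rat_dense[OF p(2)] by blast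
    have "h (p, q) u = 1" if "u \<le> a" for u using that p q by (simp add: h_def)
    moreover have "h (p, q) u = 0" if "u \<ge> a + \<delta>" for u
      using that p q by (auto simp: h_def max_def min_def divide_le_0_iff zero_le_divide_iff)
    ultimately show ?thesis by blast
  qed
  have lim: "\<exists>\<sigma>. \<forall>u. (\<lambda>k. h (from_nat (\<sigma> k)) u) \<longlonglongrightarrow> indicator {..a} u" for a
  proof -
    \<comment> \<open>The k-th ramp drops within distance \<open>1 / (k + 1)\<close> to the right of
      \<open>a\<close>; hence at each \<open>u > a\<close> all later ramps vanish.\<close>
    have "\<exists>i :: nat. (\<forall>u\<le>a. h (from_nat i) u = 1) \<and> (\<forall>u\<ge>a + inverse (Suc k). h (from_nat i) u = 0)" for k :: nat
      using ex[of "inverse (Suc k)" a] by (metis from_nat_to_nat inverse_positive_iff_positive of_nat_0_less_iff zero_less_Suc)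
    then obtain \<sigma> :: "nat \<Rightarrow> nat" where \<sigma>: "\<And>k u. u \<le> a \<Longrightarrow> h (from_nat (\<sigma> k)) u = 1"
      "\<And>k u. u \<ge> a + inverse (Suc k) \<Longrightarrow> h (from_nat (\<sigma> k)) u = 0"
      by metis
    have "(\<lambda>k. h (from_nat (\<sigma> k)) u) \<longlonglongrightarrow> indicator {..a} u" for u
    proof (cases "u \<le> a")
      case False
      have "(\<lambda>k. a + inverse (real (Suc k))) \<longlonglongrightarrow> a + 0"
        by (intro tendsto_intros LIMSEQ_inverse_real_of_nat)
      then have "\<forall>\<^sub>F k in sequentially. a + inverse (real (Suc k)) < u"
        using False by (intro order_tendstoD(2)[of _ a]) auto
      then have "\<forall>\<^sub>F k in sequentially. h (from_nat (\<sigma> k)) u = indicator {..a} u"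
        by eventually_elim (use False \<sigma>(2) in auto)
      then show ?thesis by (rule tendsto_eventually)
    qed (simp add: \<sigma>(1))
    then show ?thesis by blast
  qed
  show ?thesis
    using hc h1 lim by (intro exI[of _ "\<lambda>j. h (from_nat j)"]) blast
qed

text \<open>The mixture is a two-stage experiment: a coin with success probability \<open>t\<close>
  decides whether to draw from \<open>N1\<close> or from \<open>N0\<close>.\<close>

lemma ex_mixture:
  fixes N0 N1 :: "real measure"
  assumes N0: "prob_space N0" "sets N0 = sets borel" "measure N0 A = 1"
    and N1: "prob_space N1" "sets N1 = sets borel" "measure N1 A = 1"
    and A: "A \<in> sets borel" and t: "t \<in> {0..1}"
  shows "\<exists>N. prob_space N \<and> sets N = sets borel \<and> measure N A = 1 \<and>
    (\<forall>f :: real \<Rightarrow> real. f \<in> borel_measurable borel \<longrightarrow> (\<forall>u. f u \<in> {0..1}) \<longrightarrow>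
       (\<integral>u. f u \<partial>N) = (1 - t) * (\<integral>u. f u \<partial>N0) + t * (\<integral>u. f u \<partial>N1))"
proof -
  let ?K = "\<lambda>b. if b then N1 else N0"
  let ?N = "measure_pmf (bernoulli_pmf t) \<bind> ?K"
  have K[measurable]: "?K \<in> measure_pmf (bernoulli_pmf t) \<rightarrow>\<^sub>M prob_algebra borel"
    using N0 N1 by (auto simp: space_prob_algebra measurable_count_space_eq1)
  have p: "measure_pmf (bernoulli_pmf t) \<in> space (prob_algebra (count_space UNIV))"
    by (simp add: space_prob_algebra prob_space_measure_pmf)
  have K': "?K \<in> count_space UNIV \<rightarrow>\<^sub>M prob_algebra borel"
    using N0 N1 by (auto simp: space_prob_algebra)
  have int: "(\<integral>u. f u \<partial>?N) = (1 - t) * (\<integral>u. f u \<partial>N0) + t * (\<integral>u. f u \<partial>N1)"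
    if [measurable]: "f \<in> borel_measurable borel" and f: "\<And>u. f u \<in> {0..1}" for f :: "real \<Rightarrow> real"
    using t f by (subst prob_space.integral_bind_bounded[OF prob_space_measure_pmf that(1) K, of 1]) (auto simp: algebra_simps)
  have N: "prob_space ?N" "sets ?N = sets borel"
    using prob_space_bind'[OF p K'] sets_bind'[OF p K'] by auto
  \<comment> \<open>The concentration on \<open>A\<close> is the integral formula for the indicator
    of \<open>A\<close>.\<close>
  have "measure ?N A = (\<integral>u. indicator A u \<partial>?N)" using N A by simp
  also have "\<dots> = 1" using N0 N1 A t by (subst int) (auto simp: indicator_def)
  finally show ?thesis using int N by blast
qed

text \<open>Common concentration on a bounded interval gives tightness, hence a weakly convergent
  subsequence. Weak convergence carries over to the bounded continuous \<open>e j\<close>, and the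
  full sequences of integrals already have the limits \<open>L j\<close>.\<close>

lemma Helly_unit_interval:
  fixes e :: "nat \<Rightarrow> real \<Rightarrow> real"
  assumes e: "\<And>j. continuous_on UNIV (e j)" "\<And>j u. e j u \<in> {0..1}"
    and N: "\<And>n. prob_space (N n)" "\<And>n. sets (N n) = sets borel" "\<And>n. measure (N n) {0..1} = 1"
    and lim: "\<And>j. (\<lambda>n. \<integral>u. e j u \<partial>N n) \<longlonglongrightarrow> L j"
  shows "\<exists>M. prob_space M \<and> sets M = sets borel \<and> (\<forall>j. L j = (\<integral>u. e j u \<partial>M))"
proof -
  have rd: "real_distribution (N n)" for n
    using N by (simp add: real_distribution_def real_distribution_axioms_def)
  \<comment> \<open>Tightness is expressed by half-open intervals, so the left end point is moved
    from 0 to -1 in order to keep a possible atom at 0.\<close>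
  have "measure (N n) {-1<..1} = 1" for n
  proof -
    interpret prob_space "N n" by (rule N)
    have "measure (N n) {0..1} \<le> measure (N n) {-1<..1}"
      by (intro finite_measure_mono) (auto simp: N)
    then show ?thesis using N(3)[of n] prob_le_1[of "{-1<..1}"] by simp
  qed
  then have "tight N"
    unfolding tight_def using rd by (intro conjI allI impI exI[of _ "-1"] exI[of _ 1]) auto
  then obtain r M where r: "strict_mono r" "real_distribution M" "weak_conv_m (N \<circ> id \<circ> r) M"
    using tight_imp_convergent_subsubsequence[of N id] by (auto simp: strict_mono_id)
  have "L j = (\<integral>u. e j u \<partial>M)" for j
  proof (rule LIMSEQ_unique)
    have "isCont (e j) u" for u using e(1)[of j] by (simp add: continuous_on_eq_continuous_at)
    then show "(\<lambda>n. \<integral>u. e j u \<partial>(N \<circ> id \<circ> r) n) \<longlonglongrightarrow> (\<integral>u. e j u \<partial>M)"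
      using r rd e(2)[of j] by (intro weak_conv_imp_integral_bdd_continuous_conv[where B = 1]) (auto simp: comp_def)
    show "(\<lambda>n. \<integral>u. e j u \<partial>(N \<circ> id \<circ> r) n) \<longlonglongrightarrow> L j"
      using LIMSEQ_subseq_LIMSEQ[OF lim[of j] r(1)] by (simp add: comp_def)
  qed
  then show ?thesis using r(2)
    by (intro exI[of _ M]) (auto simp: real_distribution_def real_distribution_axioms_def)
qed

subsection \<open>Encoding a compact space in the unit interval\<close>

text \<open>Using only the digits 0 and 1 in base 3 rules out ambiguous expansions: every tail is at
  most 1/2, hence below 1, and the floor function reads off the digits exactly.\<close>

lemma ternary_digit:
  fixes \<beta> :: "nat \<Rightarrow> real"
  assumes \<beta>: "\<And>i. \<beta> i \<in> {0, 1}"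
  defines "w \<equiv> (\<Sum>i. \<beta> i * (1/3) ^ Suc i)"
  shows "w \<in> {0..1}" "\<lfloor>3 ^ Suc m * w\<rfloor> mod 3 = 1 \<longleftrightarrow> \<beta> m = 1"
proof -
  \<comment> \<open>\<open>t m\<close> is the number with ternary digits \<open>\<beta> m\<close>,
    \<open>\<beta> (m + 1)\<close>, and so on: the fractional part that remains after shifting
    \<open>w\<close> by \<open>m\<close> places.\<close>
  define t where "t m = (\<Sum>i. \<beta> (m + i) * (1/3) ^ Suc i)" for m
  have geo: "(\<lambda>i. (1/3::real) ^ Suc i) sums (1/2)"
    using sums_mult[OF geometric_sums[of "1/3::real"], of "1/3"] by simp
  have le: "0 \<le> \<beta> (m + i) * (1/3) ^ Suc i" "\<beta> (m + i) * (1/3) ^ Suc i \<le> (1/3) ^ Suc i" for m i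
    using \<beta>[of "m + i"] by auto
  have sm: "summable (\<lambda>i. \<beta> (m + i) * (1/3) ^ Suc i)" for m
    using le[of m] by (intro summable_comparison_test'[OF sums_summable[OF geo], of 0]) auto
  have t: "0 \<le> t m" "t m \<le> 1/2" for m
    using suminf_nonneg[OF sm le(1)] suminf_le[OF le(2) sm sums_summable[OF geo], folded sums_unique[OF geo]]
    by (simp_all only: t_def)
  have step: "3 * t m = \<beta> m + t (Suc m)" for m
  proof -
    have "t m = (\<Sum>i. \<beta> (m + Suc i) * (1/3) ^ Suc (Suc i)) + \<beta> m * (1/3)"
      using suminf_split_head[OF sm[of m]] by (simp add: t_def)
    also have "(\<Sum>i. \<beta> (m + Suc i) * (1/3) ^ Suc (Suc i)) = (\<Sum>i. 1/3 * (\<beta> (Suc m + i) * (1/3) ^ Suc i))"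
      by (intro arg_cong[of _ _ suminf]) (simp add: fun_eq_iff)
    also have "\<dots> = 1/3 * t (Suc m)"
      unfolding t_def using sm[of "Suc m"] by (rule suminf_mult)
    finally show ?thesis by simp
  qed
  have w: "w = t 0" by (simp add: w_def t_def)
  show "w \<in> {0..1}" using t[of 0] by (auto simp: w)
  have "\<exists>K::int. 3 ^ m * w = of_int K + t m"
  proof (induction m)
    case 0
    then show ?case by (intro exI[of _ 0]) (simp add: w)
  next
    case (Suc m)
    then obtain K :: int where K: "3 ^ m * w = of_int K + t m" by blast
    have "3 ^ Suc m * w = 3 * of_int K + \<beta> m + t (Suc m)" using K step[of m] by simp
    also have "\<dots> = of_int (3 * K + (if \<beta> m = 1 then 1 else 0)) + t (Suc m)" using \<beta>[of m] by auto
    finally show ?case by blast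
  qed
  then obtain K :: int where K: "3 ^ m * w = of_int K + t m" by blast
  have "3 ^ Suc m * w = 3 * of_int K + \<beta> m + t (Suc m)" using K step[of m] by simp
  also have "\<dots> = of_int (3 * K + (if \<beta> m = 1 then 1 else 0)) + t (Suc m)" using \<beta>[of m] by auto
  finally have "\<lfloor>3 ^ Suc m * w\<rfloor> = 3 * K + (if \<beta> m = 1 then 1 else 0)"
    using t[of "Suc m"] by (intro floor_unique) auto
  then show "\<lfloor>3 ^ Suc m * w\<rfloor> mod 3 = 1 \<longleftrightarrow> \<beta> m = 1" by auto
qed

text \<open>The truth values become the ternary digits of \<open>s x\<close>, and \<open>D m\<close>
  is the Borel set of reals whose digit at place \<open>m + 1\<close> is 1.\<close>

lemma ex_real_code_sets:
  assumes [measurable]: "\<And>m :: nat. Measurable.pred M (b m)"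
  shows "\<exists>(s :: 'a \<Rightarrow> real) D. s \<in> M \<rightarrow>\<^sub>M borel_on {0..1} \<and> (\<forall>m. D m \<in> sets borel) \<and>
    (\<forall>x m. b m x \<longleftrightarrow> s x \<in> D m)"
proof -
  define s :: "'a \<Rightarrow> real" where "s x = (\<Sum>m. of_bool (b m x) * (1/3) ^ Suc m)" for x
  define D where "D m = {u :: real. \<lfloor>3 ^ Suc m * u\<rfloor> mod 3 = 1}" for m
  have "s \<in> borel_measurable M" unfolding s_def by measurable
  moreover have "s x \<in> {0..1}" "b m x \<longleftrightarrow> s x \<in> D m" for x m
    using ternary_digit[of "\<lambda>m. of_bool (b m x)"] by (auto simp: s_def D_def)
  moreover have "D m \<in> sets borel" for m unfolding D_def by measurable
  ultimately show ?thesis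
    by (intro exI[of _ s] exI[of _ D]) (auto intro!: measurable_restrict_space2)
qed

text \<open>The comparisons \<open>e y n < q\<close> with rational \<open>q\<close> determine the coordinates of an embedding
  \<open>e\<close> into \<open>\<real>\<^sup>\<nat>\<close>; they are packed into the ternary digits of one real number.\<close>

lemma ex_real_code:
  fixes Y :: "'y::polish_space set"
  assumes "compact Y" "Y \<noteq> {}"
  shows "\<exists>(s :: 'y \<Rightarrow> real) r. s \<in> borel_on Y \<rightarrow>\<^sub>M borel_on {0..1} \<and> r \<in> borel \<rightarrow>\<^sub>M borel_on Y \<and>
    (\<forall>y\<in>Y. r (s y) = y)"
proof -
  obtain e :: "'y \<Rightarrow> nat \<Rightarrow> real" where e: "continuous_on UNIV e" "inj e"
    using ex_continuous_injection by blast
  define V where "V = e ` Y"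
  have "continuous_on Y e" "inj_on e Y" using e by (auto intro: continuous_on_subset inj_on_subset)
  then obtain g where "homeomorphism Y V e g" and "compact V"
    using homeomorphism_compact[OF assms(1)] compact_continuous_image[OF _ assms(1)] V_def by blast
  then have g: "continuous_on V g" "g ` V = Y" "\<And>y. y \<in> Y \<Longrightarrow> g (e y) = y"
    by (auto simp: homeomorphism_def)
  have V: "V \<in> sets borel" using \<open>compact V\<close> by (simp add: compact_imp_closed)
  have em: "(\<lambda>y. e y n) \<in> borel_measurable (borel_on Y)" for n
    using measurable_compose[OF borel_measurable_continuous_onI[OF e(1)] measurable_product_coordinates]
    by (rule measurable_restrict_space1)
  define q :: "nat \<Rightarrow> real" where "q k = of_rat (from_nat k)" for k
  define b where "b m y \<longleftrightarrow> (case prod_decode m of (n, k) \<Rightarrow> e y n < q k)" for m y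
  have "Measurable.pred (borel_on Y) (b m)" for m
    unfolding b_def using em by (cases "prod_decode m") simp
  then obtain s :: "'y \<Rightarrow> real" and D where s: "s \<in> borel_on Y \<rightarrow>\<^sub>M borel_on {0..1}"
    and D: "\<And>m. D m \<in> sets borel" "\<And>y m. b m y \<longleftrightarrow> s y \<in> D m"
    using ex_real_code_sets[of b "borel_on Y"] by metis
  \<comment> \<open>A coordinate is the infimum of the rationals above it. Failed comparisons
    contribute infinity and so drop out; \<open>real_of_ereal\<close> keeps \<open>R\<close> defined
    where the infimum is infinite.\<close>
  define R where "R u n = real_of_ereal
    (INF k. if u \<in> D (prod_encode (n, k)) then ereal (q k) else \<infinity>)" for u n
  have Rs: "R (s y) = e y" for y
  proof
    fix n
    have "(INF k. if e y n < q k then ereal (q k) else \<infinity>) = ereal (e y n)"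
    proof (rule antisym)
      show "ereal (e y n) \<le> (INF k. if e y n < q k then ereal (q k) else \<infinity>)"
        by (rule INF_greatest) auto
      show "(INF k. if e y n < q k then ereal (q k) else \<infinity>) \<le> ereal (e y n)"
      proof (rule dense_ge)
        fix z assume "ereal (e y n) < z"
        then obtain z' where z': "e y n < z'" "ereal z' \<le> z"
          by (metis ereal_dense2 ereal_less_eq(3) less_ereal.simps(1) less_imp_le)
        obtain p where "e y n < of_rat p" "of_rat p < z'" using of_rat_dense[OF z'(1)] by blast
        then have "e y n < q (to_nat p)" "ereal (q (to_nat p)) \<le> z"
          using z'(2) by (auto simp: q_def intro: order_trans[rotated])
        then show "(INF k. if e y n < q k then ereal (q k) else \<infinity>) \<le> z"
          by (intro INF_lower2[of "to_nat p"]) auto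
      qed
    qed
    moreover have "s y \<in> D (prod_encode (n, k)) \<longleftrightarrow> e y n < q k" for k
      using D(2)[of "prod_encode (n, k)" y] by (simp add: b_def)
    ultimately show "R (s y) n = e y n" by (simp add: R_def)
  qed
  have R: "R \<in> borel_measurable borel"
    unfolding R_def using D(1)[measurable] by (intro measurable_coordinatewise_then_product) measurable
  obtain y0 where y0: "y0 \<in> Y" using assms(2) by blast
  \<comment> \<open>Reals that decode to no point of \<open>V\<close> are sent to the fixed point
    \<open>y0\<close>. As \<open>V\<close> is compact, hence Borel, this case distinction is
    measurable.\<close>
  define r where "r u = (if R u \<in> V then g (R u) else y0)" for u
  have gm: "g \<in> borel_on V \<rightarrow>\<^sub>M borel_on Y"
    using g by (intro measurable_restrict_space2 borel_measurable_continuous_on_restrict)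
      (auto simp: space_restrict_space)
  have "(\<lambda>z. if z \<in> V then g z else y0) \<in> borel \<rightarrow>\<^sub>M borel_on Y"
    using gm y0 V by (subst measurable_If_restrict_space_iff) (auto simp: space_restrict_space)
  then have "r \<in> borel \<rightarrow>\<^sub>M borel_on Y"
    unfolding r_def using R by (rule measurable_compose[rotated])
  moreover have "r (s y) = y" if "y \<in> Y" for y
    using that g(3) by (simp add: r_def Rs V_def)
  ultimately show ?thesis using s by blast
qed

subsection \<open>Garbling on the unit interval\<close>

lemma measurable_pair_nat:
  assumes "\<And>j :: nat. (\<lambda>x. f (x, j)) \<in> M \<rightarrow>\<^sub>M N"
  shows "f \<in> M \<Otimes>\<^sub>M count_space UNIV \<rightarrow>\<^sub>M N"
proof -
  have "(\<lambda>z. f (fst z, snd z)) \<in> M \<Otimes>\<^sub>M count_space UNIV \<rightarrow>\<^sub>M N"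
    by (rule measurable_compose_countable[where f = "\<lambda>j z. f (fst z, j)"])
       (rule measurable_compose[OF measurable_fst assms], rule measurable_snd)
  then show ?thesis by simp
qed

lemma measurable_kernel_integral:
  fixes f :: "'b \<Rightarrow> real"
  assumes "K \<in> M \<rightarrow>\<^sub>M prob_algebra N" "f \<in> borel_measurable N"
  shows "(\<lambda>x. \<integral>y. f y \<partial>K x) \<in> borel_measurable M"
  using measurable_compose[OF measurable_prob_algebraD[OF assms(1)] integral_measurable_subprob_algebra[OF assms(2)]] .

lemma kernel_prob_space:
  assumes "K \<in> M \<rightarrow>\<^sub>M prob_algebra N" "x \<in> space M"
  shows "prob_space (K x)" "sets (K x) = sets N" "space (K x) = space N"
  using measurable_space[OF assms] sets_eq_imp_space_eq[of "K x" N] by (auto simp: space_prob_algebra)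

text \<open>\<open>P\<close> and \<open>Q\<close> are the channels of \<open>\<mu>\<close> and \<open>\<nu>\<close>, and \<open>s\<close> encodes the measurement as an action.
  The information order enters only through its comparison with the single policy \<open>s\<close> under \<open>\<nu>\<close>.\<close>

locale dominating_kernel = prob_space \<zeta> for \<zeta> :: "'x measure" +
  fixes MY :: "'y measure" and P Q :: "'x \<Rightarrow> 'y measure" and s :: "'y \<Rightarrow> real"
    and e :: "nat \<Rightarrow> real \<Rightarrow> real"
  assumes P: "P \<in> \<zeta> \<rightarrow>\<^sub>M prob_algebra MY" and Q: "Q \<in> \<zeta> \<rightarrow>\<^sub>M prob_algebra MY"
    and s: "s \<in> MY \<rightarrow>\<^sub>M borel_on {0..1}"
    and e_cont: "\<And>j. continuous_on UNIV (e j)" and e_unit: "\<And>j u. e j u \<in> {0..1}"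
    and e_approx: "\<And>a. \<exists>\<sigma>. \<forall>u. (\<lambda>k. e (\<sigma> k) u) \<longlonglongrightarrow> indicator {..a} u"
    and dominates: "\<And>(c :: 'x \<Rightarrow> real \<Rightarrow> real) \<delta>. case_prod c \<in> borel_measurable (\<zeta> \<Otimes>\<^sub>M borel) \<Longrightarrow>
      (\<And>x u. x \<in> space \<zeta> \<Longrightarrow> \<bar>c x u\<bar> \<le> 1) \<Longrightarrow>
      (\<And>x. x \<in> space \<zeta> \<Longrightarrow> continuous_on UNIV (c x)) \<Longrightarrow> 0 < \<delta> \<Longrightarrow>
      \<exists>\<gamma> \<in> MY \<rightarrow>\<^sub>M borel_on {0..1}.
        (\<integral>x. \<integral>y. c x (\<gamma> y) \<partial>P x \<partial>\<zeta>) \<le> (\<integral>x. \<integral>y. c x (s y) \<partial>Q x \<partial>\<zeta>) + \<delta>"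
begin

text \<open>A probability measure that charges every natural number: it gathers the countably many
  test functions into a single L2 space, and a statement true almost everywhere holds for every
  index.\<close>

abbreviation G :: "nat measure" where "G \<equiv> measure_pmf (geometric_pmf (1/2))"

lemma AE_G_iff: "(AE j in G. R j) \<longleftrightarrow> (\<forall>j. R j)"
  by (simp add: AE_measure_pmf_iff set_pmf_geometric)

sublocale zG: pair_prob_space \<zeta> G ..

lemma measurable_pair_G:
  assumes "\<And>j :: nat. (\<lambda>x. f (x, j)) \<in> M \<rightarrow>\<^sub>M N"
  shows "f \<in> M \<Otimes>\<^sub>M G \<rightarrow>\<^sub>M N"
  using measurable_pair_nat[OF assms]
  by (simp cong: measurable_cong_sets sets_pair_measure_cong)

lemma e_meas[measurable]: "e j \<in> borel_measurable borel"
  by (rule borel_measurable_continuous_onI[OF e_cont])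

lemma policy_meas: "\<gamma> \<in> MY \<rightarrow>\<^sub>M borel_on {0..1::real} \<Longrightarrow> \<gamma> \<in> borel_measurable MY"
  by (simp add: measurable_restrict_space2_iff)

text \<open>Test integrals \<open>S (y, j) = \<integral> e j dN\<^sub>y\<close> of randomized policies.  Measurability of \<open>y \<mapsto> N\<^sub>y\<close> is
  not demanded: it is recovered from that of \<open>S\<close> at the very end.\<close>

definition soft :: "('y \<times> nat \<Rightarrow> real) set" where
  "soft = {S. (\<forall>j. (\<lambda>y. S (y, j)) \<in> borel_measurable MY) \<and>
     (\<forall>y\<in>space MY. \<exists>N. prob_space N \<and> sets N = sets borel \<and> measure N {0..1} = 1 \<and>
        (\<forall>j. S (y, j) = (\<integral>u. e j u \<partial>N)))}"

definition push :: "('y \<times> nat \<Rightarrow> real) \<Rightarrow> 'x \<times> nat \<Rightarrow> real" where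
  "push S = (\<lambda>(x, j). \<integral>y. S (y, j) \<partial>P x)"

text \<open>The target to be approximated: the counterpart of \<open>push\<close> for the policy
  \<open>s\<close>, with the channel \<open>Q\<close> in place of \<open>P\<close>.\<close>

definition \<phi> :: "'x \<times> nat \<Rightarrow> real" where
  "\<phi> = (\<lambda>(x, j). \<integral>y. e j (s y) \<partial>Q x)"

lemma e_integral_unit:
  assumes "prob_space N" "sets N = sets borel"
  shows "(\<integral>u. e j u \<partial>N) \<in> {0..1}"
  using assms e_unit e_meas
  by (intro prob_space.integral_in_unit) (auto cong: measurable_cong_sets)

lemma soft_meas: "S \<in> soft \<Longrightarrow> (\<lambda>y. S (y, j)) \<in> borel_measurable MY"
  by (simp add: soft_def)

lemma soft_unit: "S \<in> soft \<Longrightarrow> y \<in> space MY \<Longrightarrow> S (y, j) \<in> {0..1}"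
  unfolding soft_def using e_integral_unit[of _ j] by fastforce

lemma kernel_unit:
  assumes K: "K \<in> \<zeta> \<rightarrow>\<^sub>M prob_algebra MY" and x: "x \<in> space \<zeta>"
    and f: "f \<in> borel_measurable MY" "\<And>y. y \<in> space MY \<Longrightarrow> f y \<in> {0..1::real}"
  shows "(\<integral>y. f y \<partial>K x) \<in> {0..1}" "integrable (K x) f"
proof -
  note Kx = kernel_prob_space[OF K x]
  have m: "f \<in> borel_measurable (K x)" using f(1) measurable_cong_sets[OF Kx(2) refl] by blast
  have u: "f y \<in> {0..1}" if "y \<in> space (K x)" for y using f(2) that Kx(3) by blast
  show "(\<integral>y. f y \<partial>K x) \<in> {0..1}" by (rule prob_space.integral_in_unit[OF Kx(1) m u])
  show "integrable (K x) f"
    using u by (intro prob_space.integrable_bounded[OF Kx(1) m, of 1]) auto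
qed

lemma push_unit: "S \<in> soft \<Longrightarrow> x \<in> space \<zeta> \<Longrightarrow> push S (x, j) \<in> {0..1}"
  unfolding push_def by (simp del: atLeastAtMost_iff) (intro kernel_unit[OF P] soft_meas soft_unit)

lemma \<phi>_unit: "x \<in> space \<zeta> \<Longrightarrow> \<phi> (x, j) \<in> {0..1}"
  unfolding \<phi>_def using policy_meas[OF s] e_unit
  by (simp del: atLeastAtMost_iff) (intro kernel_unit[OF Q] measurable_compose[OF _ e_meas])

lemma push_meas: "S \<in> soft \<Longrightarrow> (\<lambda>x. push S (x, j)) \<in> borel_measurable \<zeta>"
  unfolding push_def by (auto intro: measurable_kernel_integral[OF P] soft_meas)

lemma \<phi>_meas: "(\<lambda>x. \<phi> (x, j)) \<in> borel_measurable \<zeta>"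
  unfolding \<phi>_def
  by (auto intro!: measurable_kernel_integral[OF Q] measurable_compose[OF policy_meas[OF s] e_meas])

section \<open>Deterministic policies and convexity\<close>

lemma soft_policy:
  assumes \<gamma>: "\<gamma> \<in> MY \<rightarrow>\<^sub>M borel_on {0..1}"
  shows "(\<lambda>(y, j). e j (\<gamma> y)) \<in> soft"
proof -
  have "(\<lambda>y. e j (\<gamma> y)) \<in> borel_measurable MY" for j
    using measurable_compose[OF policy_meas[OF \<gamma>] e_meas] .
  moreover have "\<exists>N. prob_space N \<and> sets N = sets borel \<and> measure N {0..1} = 1 \<and>
      (\<forall>j. e j (\<gamma> y) = (\<integral>u. e j u \<partial>N))" if "y \<in> space MY" for y
    using measurable_space[OF \<gamma> that]
    by (intro exI[of _ "return borel (\<gamma> y)"])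
       (auto simp: prob_space_return integral_return measure_return space_restrict_space)
  ultimately show ?thesis by (simp add: soft_def)
qed

lemma soft_convex:
  assumes "S \<in> soft" "S' \<in> soft" and t: "t \<in> {0..1}"
  shows "(\<lambda>z. (1 - t) * S z + t * S' z) \<in> soft"
proof -
  have "\<exists>N. prob_space N \<and> sets N = sets borel \<and> measure N {0..1} = 1 \<and>
      (\<forall>j. (1 - t) * S (y, j) + t * S' (y, j) = (\<integral>u. e j u \<partial>N))" if y: "y \<in> space MY" for y
  proof -
    obtain N where N: "prob_space N" "sets N = sets borel" "measure N {0..1} = 1"
      "\<And>j. S (y, j) = (\<integral>u. e j u \<partial>N)"
      using assms(1) y unfolding soft_def by blast
    obtain N' where N': "prob_space N'" "sets N' = sets borel" "measure N' {0..1} = 1"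
      "\<And>j. S' (y, j) = (\<integral>u. e j u \<partial>N')"
      using assms(2) y unfolding soft_def by blast
    obtain L where L: "prob_space L" "sets L = sets borel" "measure L {0..1} = 1"
      "\<And>f :: real \<Rightarrow> real. f \<in> borel_measurable borel \<Longrightarrow> (\<And>u. f u \<in> {0..1}) \<Longrightarrow>
         (\<integral>u. f u \<partial>L) = (1 - t) * (\<integral>u. f u \<partial>N) + t * (\<integral>u. f u \<partial>N')"
      using ex_mixture[OF N(1-3) N'(1-3) _ t] by auto
    show ?thesis
      by (intro exI[of _ L]) (simp only: L(1-3) L(4)[OF e_meas e_unit] N(4) N'(4) simp_thms)
  qed
  then show ?thesis using soft_meas[OF assms(1)] soft_meas[OF assms(2)] by (auto simp: soft_def)
qed

lemma push_convex:
  assumes "S \<in> soft" "S' \<in> soft" "x \<in> space \<zeta>"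
  shows "push (\<lambda>z. (1 - t) * S z + t * S' z) (x, j) = (1 - t) * push S (x, j) + t * push S' (x, j)"
proof -
  have "integrable (P x) (\<lambda>y. S (y, j))" "integrable (P x) (\<lambda>y. S' (y, j))"
    using assms by (auto intro!: kernel_unit(2)[OF P] soft_meas soft_unit simp del: atLeastAtMost_iff)
  then show ?thesis by (simp add: push_def)
qed

text \<open>By Fubini, this is the domination inequality for the cost
  \<open>c x u = - \<integral> (\<phi> - push S) (x, j) * e j u dG(j)\<close>.\<close>

lemma push_dominates:
  assumes S: "S \<in> soft" and "0 < \<delta>"
  shows "\<exists>S'\<in>soft. (\<integral>z. (\<phi> z - push S z) * \<phi> z \<partial>(\<zeta> \<Otimes>\<^sub>M G))
    \<le> (\<integral>z. (\<phi> z - push S z) * push S' z \<partial>(\<zeta> \<Otimes>\<^sub>M G)) + \<delta>"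
proof -
  define r where "r z = \<phi> z - push S z" for z
  define c where "c x u = - (\<integral>j. r (x, j) * e j u \<partial>G)" for x u
  have r_meas[measurable]: "(\<lambda>x. r (x, j)) \<in> borel_measurable \<zeta>" for j
    unfolding r_def using \<phi>_meas push_meas[OF S] by simp
  have r1: "\<bar>r (x, j)\<bar> \<le> 1" if "x \<in> space \<zeta>" for x j
    unfolding r_def by (intro unit_diff_bounds \<phi>_unit push_unit S that)
  have re1: "\<bar>r (x, j) * e k u\<bar> \<le> 1" if "x \<in> space \<zeta>" for x j k u
    using r1[OF that, of j] e_unit[of k u] by (auto simp: abs_mult intro!: mult_le_one)
  have "(\<lambda>z. r (fst (fst z), snd z) * e (snd z) (snd (fst z))) \<in> borel_measurable ((\<zeta> \<Otimes>\<^sub>M borel) \<Otimes>\<^sub>M G)"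
    by (rule measurable_pair_G) simp
  then have c_meas: "case_prod c \<in> borel_measurable (\<zeta> \<Otimes>\<^sub>M borel)"
    unfolding c_def case_prod_beta' by (intro borel_measurable_uminus sigma_finite_measure.borel_measurable_lebesgue_integral[OF measure_pmf.sigma_finite_measure_axioms]) (simp add: case_prod_beta')
  have c1: "\<bar>c x u\<bar> \<le> 1" if "x \<in> space \<zeta>" for x u
    unfolding c_def using re1[OF that] by (auto intro!: measure_pmf.abs_integral_le)
  \<comment> \<open>Each \<open>e j\<close> is continuous and the integrands are bounded by 1, so
    dominated convergence in \<open>j\<close> gives sequential continuity.\<close>
  have c_cont: "continuous_on UNIV (c x)" if x: "x \<in> space \<zeta>" for x
    unfolding continuous_on_sequentially
  proof safe
    fix u :: "nat \<Rightarrow> real" and a assume u: "u \<longlonglongrightarrow> a"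
    have "(\<lambda>n. e j (u n)) \<longlonglongrightarrow> e j a" for j
      using e_cont[of j] u by (auto simp: continuous_on_sequentially comp_def)
    then show "(c x \<circ> u) \<longlonglongrightarrow> c x a"
      unfolding c_def comp_def using re1[OF x]
      by (intro tendsto_minus integral_dominated_convergence[where w = "\<lambda>_. 1"])
         (auto intro!: tendsto_intros)
  qed
  \<comment> \<open>Stated for a general channel because it serves twice: for \<open>P\<close> with
    the responding policy and for \<open>Q\<close> with \<open>s\<close>. The minus sign turns the
    cost inequality into the reverse inequality between inner products.\<close>
  have swap: "(\<integral>z. r z * (case z of (x, j) \<Rightarrow> \<integral>y. e j (\<gamma> y) \<partial>K x) \<partial>(\<zeta> \<Otimes>\<^sub>M G))
      = - (\<integral>x. \<integral>y. c x (\<gamma> y) \<partial>K x \<partial>\<zeta>)"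
    if K: "K \<in> \<zeta> \<rightarrow>\<^sub>M prob_algebra MY" and \<gamma>: "\<gamma> \<in> MY \<rightarrow>\<^sub>M borel_on {0..1}" for K \<gamma>
  proof -
    have em[measurable]: "(\<lambda>y. e j (\<gamma> y)) \<in> borel_measurable MY" for j
      using measurable_compose[OF policy_meas[OF \<gamma>] e_meas] .
    note Km = measurable_kernel_integral[OF K em]
    have b: "\<bar>r z * (case z of (x, j) \<Rightarrow> \<integral>y. e j (\<gamma> y) \<partial>K x)\<bar> \<le> 1" if z: "z \<in> space (\<zeta> \<Otimes>\<^sub>M G)" for z
    proof -
      obtain x j where z: "z = (x, j)" "x \<in> space \<zeta>"
        using z by (cases z) (auto simp: space_pair_measure)
      have "(\<integral>y. e j (\<gamma> y) \<partial>K x) \<in> {0..1}" by (intro kernel_unit[OF K z(2)] em e_unit)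
      then show ?thesis using r1[OF z(2), of j] by (auto simp: z(1) abs_mult intro!: mult_le_one)
    qed
    have m: "(\<lambda>z. r z * (case z of (x, j) \<Rightarrow> \<integral>y. e j (\<gamma> y) \<partial>K x)) \<in> borel_measurable (\<zeta> \<Otimes>\<^sub>M G)"
      using Km by (intro measurable_pair_G) simp
    have "(\<integral>z. r z * (case z of (x, j) \<Rightarrow> \<integral>y. e j (\<gamma> y) \<partial>K x) \<partial>(\<zeta> \<Otimes>\<^sub>M G))
        = (\<integral>x. \<integral>j. r (x, j) * (\<integral>y. e j (\<gamma> y) \<partial>K x) \<partial>G \<partial>\<zeta>)"
      using zG.integral_fst'[OF zG.integrable_bounded[OF m b]] by simp
    also have "\<dots> = (\<integral>x. - (\<integral>y. c x (\<gamma> y) \<partial>K x) \<partial>\<zeta>)"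
    proof (rule Bochner_Integration.integral_cong[OF refl])
      fix x assume x: "x \<in> space \<zeta>"
      note Kx = kernel_prob_space[OF K x]
      interpret Kx: prob_space "K x" by (rule Kx)
      interpret KG: pair_prob_space "K x" G ..
      have "(\<lambda>z. r (x, snd z) * e (snd z) (\<gamma> (fst z))) \<in> borel_measurable (K x \<Otimes>\<^sub>M G)"
        using em Kx(2) by (intro measurable_pair_G) (simp cong: measurable_cong_sets)
      then have "integrable (K x \<Otimes>\<^sub>M G) (\<lambda>(y, j). r (x, j) * e j (\<gamma> y))"
        using re1[OF x] by (intro KG.integrable_bounded[of _ 1]) (auto simp: case_prod_beta')
      from KG.Fubini_integral[OF this]
      show "(\<integral>j. r (x, j) * (\<integral>y. e j (\<gamma> y) \<partial>K x) \<partial>G) = - (\<integral>y. c x (\<gamma> y) \<partial>K x)"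
        by (simp add: c_def)
    qed
    finally show ?thesis by simp
  qed
  obtain \<gamma> where \<gamma>: "\<gamma> \<in> MY \<rightarrow>\<^sub>M borel_on {0..1}"
    "(\<integral>x. \<integral>y. c x (\<gamma> y) \<partial>P x \<partial>\<zeta>) \<le> (\<integral>x. \<integral>y. c x (s y) \<partial>Q x \<partial>\<zeta>) + \<delta>"
    using dominates[of c \<delta>] c_meas c1 c_cont \<open>0 < \<delta>\<close> by blast
  have "(\<integral>z. r z * \<phi> z \<partial>(\<zeta> \<Otimes>\<^sub>M G)) \<le> (\<integral>z. r z * push (\<lambda>(y, j). e j (\<gamma> y)) z \<partial>(\<zeta> \<Otimes>\<^sub>M G)) + \<delta>"
    using \<gamma>(2) swap[OF P \<gamma>(1)] swap[OF Q s] by (simp add: push_def \<phi>_def)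
  then show ?thesis using soft_policy[OF \<gamma>(1)] by (auto simp: r_def)
qed

text \<open>The convex set is the image of \<open>soft\<close> under \<open>push\<close>; the dual
  hypothesis of the L2 argument is exactly \<open>push_dominates\<close>.\<close>

lemma ex_soft_approx:
  assumes "0 < \<epsilon>"
  shows "\<exists>S\<in>soft. (\<integral>z. (\<phi> z - push S z)\<^sup>2 \<partial>(\<zeta> \<Otimes>\<^sub>M G)) < \<epsilon>"
proof -
  have "\<exists>f\<in>push ` soft. (\<integral>z. (\<phi> z - f z)\<^sup>2 \<partial>(\<zeta> \<Otimes>\<^sub>M G)) < \<epsilon>"
  proof (rule zG.L2_approx_convex)
    show "\<phi> \<in> borel_measurable (\<zeta> \<Otimes>\<^sub>M G)" by (rule measurable_pair_G[OF \<phi>_meas])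
    show "\<phi> z \<in> {0..1}" if "z \<in> space (\<zeta> \<Otimes>\<^sub>M G)" for z
      using that \<phi>_unit by (cases z) (auto simp: space_pair_measure)
    show "push ` soft \<noteq> {}" using soft_policy[OF s] by blast
    show "f \<in> borel_measurable (\<zeta> \<Otimes>\<^sub>M G)" if "f \<in> push ` soft" for f
      using that measurable_pair_G[OF push_meas] by auto
    show "f z \<in> {0..1}" if "f \<in> push ` soft" "z \<in> space (\<zeta> \<Otimes>\<^sub>M G)" for f z
      using that push_unit by (cases z) (auto simp: space_pair_measure)
    show "\<exists>h\<in>push ` soft. \<forall>z\<in>space (\<zeta> \<Otimes>\<^sub>M G). h z = (1 - t) * f z + t * g z"
      if fg: "f \<in> push ` soft" "g \<in> push ` soft" and t: "t \<in> {0..1}" for f g t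
    proof -
      obtain S S' where S: "S \<in> soft" "S' \<in> soft" "f = push S" "g = push S'" using fg by blast
      have "\<forall>z\<in>space (\<zeta> \<Otimes>\<^sub>M G). push (\<lambda>z. (1 - t) * S z + t * S' z) z = (1 - t) * f z + t * g z"
        using push_convex[OF S(1,2)] by (auto simp: S(3,4) space_pair_measure)
      then show ?thesis using soft_convex[OF S(1,2) t] by blast
    qed
    show "\<exists>g\<in>push ` soft. (\<integral>z. (\<phi> z - f z) * \<phi> z \<partial>(\<zeta> \<Otimes>\<^sub>M G))
        \<le> (\<integral>z. (\<phi> z - f z) * g z \<partial>(\<zeta> \<Otimes>\<^sub>M G)) + \<delta>"
      if "f \<in> push ` soft" "0 < \<delta>" for f \<delta>
      using that push_dominates by blast
  qed fact
  then show ?thesis by blast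
qed

text \<open>The selection takes place among the functions on \<open>Y\<close> themselves, with
  respect to the law of the measurement under \<open>P\<close>, so that limits exist for individual
  measurements and not only for the images under \<open>push\<close>.\<close>

lemma ex_kernel_approx:
  "\<exists>S. (\<forall>n. S n \<in> soft \<and> (\<integral>z. (\<phi> z - push (S n) z)\<^sup>2 \<partial>(\<zeta> \<Otimes>\<^sub>M G)) < inverse (Suc n)) \<and>
     (AE y in \<zeta> \<bind> P. \<forall>j. Cauchy (\<lambda>n. S n (y, j)))"
proof -
  have m: "prob_space (\<zeta> \<bind> P)" "sets (\<zeta> \<bind> P) = sets MY"
    using prob_space_bind'[OF _ P] sets_bind'[OF _ P] prob_space_axioms by (auto simp: space_prob_algebra)
  note sm = sets_eq_imp_space_eq[OF m(2)]
  interpret m: prob_space "\<zeta> \<bind> P" by (rule m)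
  interpret mG: pair_prob_space "\<zeta> \<bind> P" G ..
  define D where "D S = (\<integral>z. (\<phi> z - push S z)\<^sup>2 \<partial>(\<zeta> \<Otimes>\<^sub>M G))" for S
  define C where "C n = {S \<in> soft. D S < inverse (Suc n)}" for n :: nat
  have half: "(\<lambda>z. (S z + S' z) / 2) = (\<lambda>z. (1 - 1/2) * S z + 1/2 * S' z)" for S S' :: "'y \<times> nat \<Rightarrow> real"
    by (simp add: fun_eq_iff field_simps)
  have mid: "(\<lambda>z. (S z + S' z) / 2) \<in> soft" "D (\<lambda>z. (S z + S' z) / 2) \<le> (D S + D S') / 2"
    if S: "S \<in> soft" "S' \<in> soft" for S S'
  proof -
    show mid: "(\<lambda>z. (S z + S' z) / 2) \<in> soft"
      unfolding half using S by (intro soft_convex) auto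
    have i: "integrable (\<zeta> \<Otimes>\<^sub>M G) (\<lambda>z. (\<phi> z - push S z)\<^sup>2)" if "S \<in> soft" for S
    proof (rule zG.integrable_bounded[of _ 1])
      show "(\<lambda>z. (\<phi> z - push S z)\<^sup>2) \<in> borel_measurable (\<zeta> \<Otimes>\<^sub>M G)"
        using \<phi>_meas push_meas[OF that] by (intro measurable_pair_G) simp
      show "\<bar>(\<phi> z - push S z)\<^sup>2\<bar> \<le> 1" if "z \<in> space (\<zeta> \<Otimes>\<^sub>M G)" for z
        using that unit_diff_bounds(2)[OF \<phi>_unit push_unit[OF \<open>S \<in> soft\<close>]]
        by (cases z) (auto simp: space_pair_measure)
    qed
    \<comment> \<open>\<open>push\<close> respects midpoints and squaring is convex, so a midpoint
      of two approximations is within the same tolerance.\<close>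
    have "D (\<lambda>z. (S z + S' z) / 2) \<le> (\<integral>z. ((\<phi> z - push S z)\<^sup>2 + (\<phi> z - push S' z)\<^sup>2) / 2 \<partial>(\<zeta> \<Otimes>\<^sub>M G))"
      unfolding D_def
    proof (rule integral_mono)
      fix z assume "z \<in> space (\<zeta> \<Otimes>\<^sub>M G)"
      then obtain x j where z: "z = (x, j)" "x \<in> space \<zeta>" by (cases z) (auto simp: space_pair_measure)
      have p: "push (\<lambda>z. (S z + S' z) / 2) z = (push S z + push S' z) / 2"
        unfolding half z(1) push_convex[OF S z(2)] by simp
      have "0 \<le> (push S z - push S' z)\<^sup>2" by simp
      then show "(\<phi> z - push (\<lambda>z. (S z + S' z) / 2) z)\<^sup>2 \<le> ((\<phi> z - push S z)\<^sup>2 + (\<phi> z - push S' z)\<^sup>2) / 2"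
        unfolding p by (simp add: power2_eq_square field_simps)
    qed (use i S mid in auto)
    then show "D (\<lambda>z. (S z + S' z) / 2) \<le> (D S + D S') / 2"
      using i S by (simp add: D_def)
  qed
  have "\<exists>S. (\<forall>n. S n \<in> C n) \<and> (AE z in (\<zeta> \<bind> P) \<Otimes>\<^sub>M G. Cauchy (\<lambda>n. S n z))"
  proof (rule mG.AE_Cauchy_selection_convex)
    show "S \<in> borel_measurable ((\<zeta> \<bind> P) \<Otimes>\<^sub>M G)" if "S \<in> C n" for n S
      using that soft_meas measurable_cong_sets[OF m(2) refl]
      by (intro measurable_pair_G) (auto simp: C_def)
    show "S z \<in> {0..1}" if "S \<in> C n" "z \<in> space ((\<zeta> \<bind> P) \<Otimes>\<^sub>M G)" for n S z
      using that soft_unit by (cases z) (auto simp: C_def space_pair_measure sm)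
    show "C n \<noteq> {}" for n
      using ex_soft_approx[of "inverse (Suc n)"] by (auto simp: C_def D_def)
    show "decseq C"
    proof (rule decseq_SucI, rule subsetI)
      fix n S assume S: "S \<in> C (Suc n)"
      have "inverse (real (Suc (Suc n))) \<le> inverse (real (Suc n))" by simp
      with S show "S \<in> C n" unfolding C_def by (blast intro: less_le_trans)
    qed
    show "(\<lambda>z. (S z + S' z) / 2) \<in> C n" if "S \<in> C n" "S' \<in> C n" for n S S'
      using that mid[of S S'] by (auto simp: C_def)
  qed
  then obtain S where S: "\<And>n. S n \<in> C n" "AE z in (\<zeta> \<bind> P) \<Otimes>\<^sub>M G. Cauchy (\<lambda>n. S n z)" by blast
  then have "AE y in \<zeta> \<bind> P. \<forall>j. Cauchy (\<lambda>n. S n (y, j))"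
    using mG.AE_pair[OF S(2)] by (simp add: AE_G_iff)
  then show ?thesis using S(1) by (auto simp: C_def D_def)
qed

text \<open>Helly's theorem turns the pointwise limits of the test integrals into measures.\<close>

lemma ex_limit_kernel:
  "\<exists>K. (\<forall>y. prob_space (K y) \<and> sets (K y) = sets borel) \<and>
     (\<forall>j. (\<lambda>y. \<integral>u. e j u \<partial>K y) \<in> borel_measurable MY) \<and>
     (AE x in \<zeta>. \<forall>j. (\<integral>y. e j (s y) \<partial>Q x) = (\<integral>y. \<integral>u. e j u \<partial>K y \<partial>P x))"
proof -
  obtain S where S: "\<And>n. S n \<in> soft"
    and S_lim: "\<And>n. (\<integral>z. (\<phi> z - push (S n) z)\<^sup>2 \<partial>(\<zeta> \<Otimes>\<^sub>M G)) < inverse (Suc n)"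
    and S_AE: "AE y in \<zeta> \<bind> P. \<forall>j. Cauchy (\<lambda>n. S n (y, j))"
    using ex_kernel_approx by blast
  note [measurable] = soft_meas[OF S]
  define good where "good y \<longleftrightarrow> (\<forall>j. Cauchy (\<lambda>n. S n (y, j)))" for y
  have good_meas[measurable]: "Measurable.pred MY good" unfolding good_def by measurable
  \<comment> \<open>The default \<open>e j 0\<close> is the test integral of the point mass at 0, so
    \<open>L y\<close> comes from a probability measure even where the sequence diverges.\<close>
  define L where "L y j = (if good y then lim (\<lambda>n. S n (y, j)) else e j 0)" for y j
  have L_meas[measurable]: "(\<lambda>y. L y j) \<in> borel_measurable MY" for j unfolding L_def by measurable
  have L_lim: "(\<lambda>n. S n (y, j)) \<longlonglongrightarrow> L y j" if "good y" for y j
    using that by (auto simp: good_def L_def Cauchy_convergent_iff convergent_LIMSEQ_iff)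
  have "\<exists>N. prob_space N \<and> sets N = sets borel \<and> (y \<in> space MY \<longrightarrow> (\<forall>j. L y j = (\<integral>u. e j u \<partial>N)))" for y
  proof (cases "y \<in> space MY \<and> good y")
    case True
    then have "\<exists>N. prob_space N \<and> sets N = sets borel \<and> measure N {0..1} = 1 \<and>
        (\<forall>j. S n (y, j) = (\<integral>u. e j u \<partial>N))" for n
      using S[of n] by (simp add: soft_def)
    then obtain N where "\<And>n. prob_space (N n)" "\<And>n. sets (N n) = sets borel"
      "\<And>n. measure (N n) {0..1} = 1" "\<And>n j. S n (y, j) = (\<integral>u. e j u \<partial>N n)" by metis
    moreover have "(\<lambda>n. S n (y, j)) \<longlonglongrightarrow> L y j" for j using L_lim True by blast
    ultimately show ?thesis
      using Helly_unit_interval[of e N "L y"] e_cont e_unit by auto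
  next
    case False
    then have "y \<in> space MY \<longrightarrow> (\<forall>j. L y j = (\<integral>u. e j u \<partial>return borel 0))"
      by (auto simp: L_def integral_return)
    then show ?thesis by (intro exI[of _ "return borel 0"]) (simp add: prob_space_return)
  qed
  then obtain K where K: "\<And>y. prob_space (K y)" "\<And>y. sets (K y) = sets borel"
    "\<And>y j. y \<in> space MY \<Longrightarrow> L y j = (\<integral>u. e j u \<partial>K y)" by metis
  define TL where "TL = (\<lambda>(x, j). \<integral>y. L y j \<partial>P x)"
  have L_unit: "L y j \<in> {0..1}" if "y \<in> space MY" for y j
    using e_integral_unit K that by simp
  have TL_meas: "(\<lambda>x. TL (x, j)) \<in> borel_measurable \<zeta>" for j
    unfolding TL_def by (simp add: measurable_kernel_integral[OF P L_meas])
  have TL_unit: "TL (x, j) \<in> {0..1}" if "x \<in> space \<zeta>" for x j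
    unfolding TL_def by (simp del: atLeastAtMost_iff) (intro kernel_unit[OF P that] L_meas L_unit)
  \<comment> \<open>A null set of the mixture \<open>\<zeta> \<bind> P\<close> is null under
    \<open>P x\<close> for almost every \<open>x\<close>; this lets the limit pass under the
    integral over \<open>P x\<close>.\<close>
  have "AE x in \<zeta>. AE y in P x. good y"
    using S_AE AE_bind[OF measurable_prob_algebraD[OF P] good_meas] by (simp add: good_def)
  moreover have "(\<lambda>n. push (S n) (x, j)) \<longlonglongrightarrow> TL (x, j)"
    if x: "x \<in> space \<zeta>" and ae: "AE y in P x. good y" for x j
  proof -
    note Px = kernel_prob_space[OF P x]
    interpret Px: prob_space "P x" by (rule Px)
    have mm: "f \<in> borel_measurable MY \<Longrightarrow> f \<in> borel_measurable (P x)" for f :: "'y \<Rightarrow> real"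
      using measurable_cong_sets[OF Px(2) refl] by blast
    have "(\<lambda>n. \<integral>y. S n (y, j) \<partial>P x) \<longlonglongrightarrow> (\<integral>y. L y j \<partial>P x)"
    proof (rule integral_dominated_convergence[where w = "\<lambda>_. 1"])
      show "AE y in P x. (\<lambda>n. S n (y, j)) \<longlonglongrightarrow> L y j" using ae by eventually_elim (rule L_lim)
      show "AE y in P x. norm (S n (y, j)) \<le> 1" for n
        using soft_unit[OF S[of n]] by (intro AE_I2) (simp add: Px(3))
    qed (auto intro!: mm soft_meas S L_meas)
    then show ?thesis by (simp add: push_def TL_def)
  qed
  ultimately have "AE x in \<zeta>. \<forall>j. (\<lambda>n. push (S n) (x, j)) \<longlonglongrightarrow> TL (x, j)" by (auto elim: AE_mp)
  then have "AE x in distr (\<zeta> \<Otimes>\<^sub>M G) \<zeta> fst. \<forall>j. (\<lambda>n. push (S n) (x, j)) \<longlonglongrightarrow> TL (x, j)"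
    unfolding prob_space.distr_pair_fst[OF prob_space_measure_pmf] .
  then have "AE z in \<zeta> \<Otimes>\<^sub>M G. \<forall>j. (\<lambda>n. push (S n) (fst z, j)) \<longlonglongrightarrow> TL (fst z, j)"
    by (rule AE_distrD[OF measurable_fst])
  then have "AE z in \<zeta> \<Otimes>\<^sub>M G. (\<lambda>n. push (S n) z) \<longlonglongrightarrow> TL z"
    by eventually_elim (metis prod.collapse)
  note pushm = measurable_pair_G[of "push (S n)" for n, OF push_meas[OF S]]
    and \<phi>m = measurable_pair_G[OF \<phi>_meas] and TLm = measurable_pair_G[OF TL_meas]
  \<comment> \<open>The errors, below \<open>1 / (n + 1)\<close>, converge to the error of the
    limit, which is therefore 0; hence \<open>\<phi>\<close> and \<open>TL\<close> agree almost
    everywhere.\<close>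
  have lim: "(\<lambda>n. \<integral>z. (\<phi> z - push (S n) z)\<^sup>2 \<partial>(\<zeta> \<Otimes>\<^sub>M G)) \<longlonglongrightarrow> (\<integral>z. (\<phi> z - TL z)\<^sup>2 \<partial>(\<zeta> \<Otimes>\<^sub>M G))"
  proof (rule integral_dominated_convergence[where w = "\<lambda>_. 1"])
    show "AE z in \<zeta> \<Otimes>\<^sub>M G. (\<lambda>n. (\<phi> z - push (S n) z)\<^sup>2) \<longlonglongrightarrow> (\<phi> z - TL z)\<^sup>2"
      using \<open>AE z in \<zeta> \<Otimes>\<^sub>M G. (\<lambda>n. push (S n) z) \<longlonglongrightarrow> TL z\<close>
      by eventually_elim (intro tendsto_intros)
    show "AE z in \<zeta> \<Otimes>\<^sub>M G. norm ((\<phi> z - push (S n) z)\<^sup>2) \<le> 1" for n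
    proof (rule AE_I2)
      show "norm ((\<phi> z - push (S n) z)\<^sup>2) \<le> 1" if "z \<in> space (\<zeta> \<Otimes>\<^sub>M G)" for z
        using that unit_diff_bounds(2)[OF \<phi>_unit push_unit[OF S]]
        by (cases z) (auto simp: space_pair_measure)
    qed
  qed (use pushm \<phi>m TLm in auto)
  have "(\<integral>z. (\<phi> z - TL z)\<^sup>2 \<partial>(\<zeta> \<Otimes>\<^sub>M G)) \<le> 0"
    using S_lim by (intro LIMSEQ_le[OF lim LIMSEQ_inverse_real_of_nat]) (auto intro: less_imp_le)
  moreover have "0 \<le> (\<integral>z. (\<phi> z - TL z)\<^sup>2 \<partial>(\<zeta> \<Otimes>\<^sub>M G))" by simp
  moreover have "integrable (\<zeta> \<Otimes>\<^sub>M G) (\<lambda>z. (\<phi> z - TL z)\<^sup>2)"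
  proof (rule zG.integrable_bounded[of _ 1])
    show "\<bar>(\<phi> z - TL z)\<^sup>2\<bar> \<le> 1" if "z \<in> space (\<zeta> \<Otimes>\<^sub>M G)" for z
      using that unit_diff_bounds(2)[OF \<phi>_unit TL_unit]
      by (cases z) (auto simp: space_pair_measure)
  qed (use \<phi>m TLm in auto)
  ultimately have "AE z in \<zeta> \<Otimes>\<^sub>M G. (\<phi> z - TL z)\<^sup>2 = 0"
    by (subst integral_nonneg_eq_0_iff_AE[symmetric]) auto
  then have "AE z in \<zeta> \<Otimes>\<^sub>M G. \<phi> z = TL z" by simp
  from zG.AE_pair[OF this] have "AE x in \<zeta>. \<forall>j. \<phi> (x, j) = TL (x, j)" by (simp add: AE_G_iff)
  moreover have "TL (x, j) = (\<integral>y. \<integral>u. e j u \<partial>K y \<partial>P x)" if "x \<in> space \<zeta>" for x j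
    unfolding TL_def using K(3) kernel_prob_space(3)[OF P that]
    by (auto intro!: Bochner_Integration.integral_cong)
  ultimately have "AE x in \<zeta>. \<forall>j. (\<integral>y. e j (s y) \<partial>Q x) = (\<integral>y. \<integral>u. e j u \<partial>K y \<partial>P x)"
    by (auto simp: \<phi>_def elim!: AE_mp intro!: AE_I2)
  moreover have "(\<lambda>y. \<integral>u. e j u \<partial>K y) \<in> borel_measurable MY" for j
    using L_meas[of j] K(3) by (subst measurable_cong[of _ _ "\<lambda>y. L y j"]) auto
  ultimately show ?thesis using K(1,2) by blast
qed

section \<open>From test integrals to distribution functions\<close>

lemma test_integrals_tendsto:
  assumes N: "prob_space N" "f \<in> borel_measurable N"
    and \<sigma>: "\<And>u. (\<lambda>k. e (\<sigma> k) u) \<longlonglongrightarrow> indicator {..a} u"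
  shows "(\<lambda>k. \<integral>y. e (\<sigma> k) (f y) \<partial>N) \<longlonglongrightarrow> measure N (f -` {..a} \<inter> space N)"
proof -
  interpret N: prob_space N by (rule N)
  have "(\<lambda>k. \<integral>y. e (\<sigma> k) (f y) \<partial>N) \<longlonglongrightarrow> (\<integral>y. indicator {..a} (f y) \<partial>N)"
    using N(2) e_unit \<sigma> by (intro integral_dominated_convergence[where w = "\<lambda>_. 1"])
      (auto intro!: measurable_compose[OF N(2) e_meas])
  also have "(\<integral>y. indicator {..a} (f y) \<partial>N) = (\<integral>y. indicator (f -` {..a} \<inter> space N) y \<partial>N)"
    by (intro Bochner_Integration.integral_cong) (auto simp: indicator_def)
  also have "\<dots> = measure N (f -` {..a} \<inter> space N)" by simp
  finally show ?thesis .
qed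

text \<open>Ramps tending to the indicator of a half-line turn equal test integrals into equal
  distribution functions, which determine measures on the line. The same limits make the values of
  \<open>K\<close> on half-lines measurable.\<close>

lemma ex_garbling:
  "\<exists>K\<in>MY \<rightarrow>\<^sub>M prob_algebra borel. AE x in \<zeta>. distr (Q x) borel s = P x \<bind> K"
proof -
  obtain K where K: "\<And>y. prob_space (K y)" "\<And>y. sets (K y) = sets borel"
    and Km: "\<And>j. (\<lambda>y. \<integral>u. e j u \<partial>K y) \<in> borel_measurable MY"
    and ae: "AE x in \<zeta>. \<forall>j. (\<integral>y. e j (s y) \<partial>Q x) = (\<integral>y. \<integral>u. e j u \<partial>K y \<partial>P x)"
    using ex_limit_kernel by blast
  have Klim: "(\<lambda>k. \<integral>u. e (\<sigma> k) u \<partial>K y) \<longlonglongrightarrow> measure (K y) {..a}"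
    if "\<forall>u. (\<lambda>k. e (\<sigma> k) u) \<longlonglongrightarrow> indicator {..a} u" for \<sigma> a y
    using test_integrals_tendsto[OF K(1), of "\<lambda>u. u" y \<sigma> a] that sets_eq_imp_space_eq[OF K(2)[of y]] K(2)[of y]
    by (simp add: measurable_ident_sets)
  have K_meas: "(\<lambda>y. measure (K y) {..a}) \<in> borel_measurable MY" for a
  proof -
    obtain \<sigma> where "\<forall>u. (\<lambda>k. e (\<sigma> k) u) \<longlonglongrightarrow> indicator {..a} u" using e_approx[of a] by blast
    then show ?thesis using Km by (intro borel_measurable_LIMSEQ_real[OF Klim]) auto
  qed
  \<comment> \<open>Half-lines generate the Borel sets and are stable under intersection, so
    measurability of \<open>K\<close> need only be checked on them.\<close>
  have KP: "K \<in> MY \<rightarrow>\<^sub>M prob_algebra borel"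
  proof (rule measurable_prob_algebra_generated[where \<Omega> = UNIV and G = "range (\<lambda>a :: real. {..a})"])
    show "sets borel = sigma_sets UNIV (range (\<lambda>a :: real. {..a}))"
      by (subst borel_eq_atMost) simp
    show "Int_stable (range (\<lambda>a :: real. {..a}))"
      by (auto simp: Int_stable_def)
    show "(\<lambda>y. emeasure (K y) A) \<in> borel_measurable MY" if "A \<in> range (\<lambda>a :: real. {..a})" for A
      using that K_meas K(1) by (auto simp: finite_measure.emeasure_eq_measure[OF prob_space.finite_measure])
  qed (use K in auto)
  have eqD: "distr (Q x) borel s = P x \<bind> K"
    if x: "x \<in> space \<zeta>" and eq: "\<forall>j. (\<integral>y. e j (s y) \<partial>Q x) = (\<integral>y. \<integral>u. e j u \<partial>K y \<partial>P x)" for x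
  proof (rule cdf_unique)
    note Px = kernel_prob_space[OF P x] and Qx = kernel_prob_space[OF Q x]
    interpret Px: prob_space "P x" by (rule Px)
    interpret Qx: prob_space "Q x" by (rule Qx)
    have sm: "s \<in> borel_measurable (Q x)"
      using policy_meas[OF s] measurable_cong_sets[OF Qx(2) refl] by blast
    have Pxs: "P x \<in> space (prob_algebra MY)" using measurable_space[OF P x] .
    show "real_distribution (distr (Q x) borel s)" using Qx.real_distribution_distr[OF sm] .
    show "real_distribution (P x \<bind> K)"
      using prob_space_bind'[OF Pxs KP] sets_bind'[OF Pxs KP]
      by (simp add: real_distribution_def real_distribution_axioms_def)
    show "cdf (distr (Q x) borel s) = cdf (P x \<bind> K)"
    proof
      fix a
      obtain \<sigma> where \<sigma>: "\<forall>u. (\<lambda>k. e (\<sigma> k) u) \<longlonglongrightarrow> indicator {..a} u" using e_approx[of a] by blast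
      have mm: "f \<in> borel_measurable MY \<Longrightarrow> f \<in> borel_measurable (P x)" for f :: "'y \<Rightarrow> real"
        using measurable_cong_sets[OF Px(2) refl] by blast
      have "(\<lambda>k. \<integral>y. \<integral>u. e (\<sigma> k) u \<partial>K y \<partial>P x) \<longlonglongrightarrow> (\<integral>y. measure (K y) {..a} \<partial>P x)"
      proof (rule integral_dominated_convergence[where w = "\<lambda>_. 1"])
        show "AE y in P x. norm (\<integral>u. e (\<sigma> k) u \<partial>K y) \<le> 1" for k
          using e_integral_unit[OF K(1) K(2)] by (intro AE_I2) simp
      qed (use Klim[OF \<sigma>] Km K_meas in \<open>auto intro: mm\<close>)
      then have "measure (Q x) (s -` {..a} \<inter> space (Q x)) = (\<integral>y. measure (K y) {..a} \<partial>P x)"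
        using test_integrals_tendsto[OF Qx(1) sm, of \<sigma> a] \<sigma> eq LIMSEQ_unique by auto
      moreover have "K \<in> P x \<rightarrow>\<^sub>M subprob_algebra borel"
        using measurable_prob_algebraD[OF KP] measurable_cong_sets[OF Px(2) refl] by blast
      ultimately show "cdf (distr (Q x) borel s) a = cdf (P x \<bind> K) a"
        using sm by (simp add: cdf_def measure_distr Px.measure_bind[of _ borel])
    qed
  qed
  have "AE x in \<zeta>. distr (Q x) borel s = P x \<bind> K"
    using ae AE_space by eventually_elim (rule eqD)
  then show ?thesis using KP by blast
qed

end

subsection \<open>Information structures\<close>

text \<open>The kernel sends \<open>x\<close> to the joint law of \<open>x\<close> and its
  measurement. Writing the information structure as a bind opens the way from the disintegration of
  sets to iterated integrals of costs.\<close>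

lemma measurement_channel_eq_bind:
  fixes X :: "'x::polish_space set" and Y :: "'y::polish_space set"
  assumes ch: "measurement_channel X Y \<zeta> \<mu> Q" and \<mu>: "information_structure X Y \<zeta> \<mu>"
    and \<zeta>: "prob_space \<zeta>" "sets \<zeta> = sets (borel_on X)"
  shows "\<mu> = \<zeta> \<bind> (\<lambda>x. distr (Q x) (borel_on X \<Otimes>\<^sub>M borel_on Y) (Pair x))"
    and "(\<lambda>x. distr (Q x) (borel_on X \<Otimes>\<^sub>M borel_on Y) (Pair x))
      \<in> \<zeta> \<rightarrow>\<^sub>M prob_algebra (borel_on X \<Otimes>\<^sub>M borel_on Y)"
proof -
  let ?XY = "borel_on X \<Otimes>\<^sub>M borel_on Y"
  let ?K = "\<lambda>x. distr (Q x) ?XY (Pair x)"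
  have Q: "Q \<in> borel_on X \<rightarrow>\<^sub>M prob_algebra (borel_on Y)"
    using ch by (simp add: measurement_channel_def stochastic_kernel_def)
  have "?K \<in> borel_on X \<rightarrow>\<^sub>M prob_algebra ?XY"
    by (rule measurable_distr_prob_space2[OF Q]) simp
  then show K: "?K \<in> \<zeta> \<rightarrow>\<^sub>M prob_algebra ?XY"
    using measurable_cong_sets[OF \<zeta>(2) refl] by blast
  have sets: "sets \<mu> = sets ?XY" using \<mu> by (simp add: information_structure_def)
  have ne: "space \<zeta> \<noteq> {}" using prob_space.not_empty[OF \<zeta>(1)] .
  have \<zeta>P: "\<zeta> \<in> space (prob_algebra \<zeta>)" using \<zeta>(1) by (simp add: space_prob_algebra)
  show "\<mu> = \<zeta> \<bind> ?K"
  proof (rule measure_eqI)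
    show "sets \<mu> = sets (\<zeta> \<bind> ?K)" using sets sets_bind'[OF \<zeta>P K] by simp
    fix C assume "C \<in> sets \<mu>"
    then have C: "C \<in> sets ?XY" using sets by simp
    have "emeasure \<mu> C = (\<integral>\<^sup>+ x. emeasure (Q x) {y. (x, y) \<in> C} \<partial>\<zeta>)"
      using ch C by (simp add: measurement_channel_def)
    also have "\<dots> = (\<integral>\<^sup>+ x. emeasure (?K x) C \<partial>\<zeta>)"
    proof (rule nn_integral_cong)
      fix x assume "x \<in> space \<zeta>"
      then have x: "x \<in> space (borel_on X)" using sets_eq_imp_space_eq[OF \<zeta>(2)] by simp
      note Qx = kernel_prob_space[OF Q x]
      have "Pair x \<in> Q x \<rightarrow>\<^sub>M ?XY"
        using measurable_Pair1'[OF x] measurable_cong_sets[OF Qx(2) refl] by blast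
      moreover have "{y. (x, y) \<in> C} = Pair x -` C \<inter> space (Q x)"
        using sets.sets_into_space[OF C] Qx(3) by (auto simp: space_pair_measure)
      ultimately show "emeasure (Q x) {y. (x, y) \<in> C} = emeasure (?K x) C"
        using C by (simp add: emeasure_distr)
    qed
    also have "\<dots> = emeasure (\<zeta> \<bind> ?K) C"
      using emeasure_bind[OF ne measurable_prob_algebraD[OF K] C] by simp
    finally show "emeasure \<mu> C = emeasure (\<zeta> \<bind> ?K) C" .
  qed
qed

lemma expected_cost_eq_channel:
  fixes X :: "'x::polish_space set" and Y :: "'y::polish_space set" and U :: "'u::polish_space set"
  assumes ch: "measurement_channel X Y \<zeta> \<mu> Q" and \<mu>: "information_structure X Y \<zeta> \<mu>"
    and \<zeta>: "prob_space \<zeta>" "sets \<zeta> = sets (borel_on X)"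
    and c: "(c, U) \<in> compact_continuous_problems X" and \<gamma>: "\<gamma> \<in> policies Y U"
  shows "expected_cost c \<mu> \<gamma> = (\<integral>x. \<integral>y. c x (\<gamma> y) \<partial>Q x \<partial>\<zeta>)"
proof -
  let ?XY = "borel_on X \<Otimes>\<^sub>M borel_on Y"
  note bind = measurement_channel_eq_bind[OF ch \<mu> \<zeta>]
  have Q: "Q \<in> borel_on X \<rightarrow>\<^sub>M prob_algebra (borel_on Y)"
    using ch by (simp add: measurement_channel_def stochastic_kernel_def)
  obtain C where C: "\<And>x u. x \<in> X \<Longrightarrow> u \<in> U \<Longrightarrow> \<bar>c x u\<bar> \<le> C"
    and cm: "case_prod c \<in> borel_measurable (borel_on X \<Otimes>\<^sub>M borel_on U)"
    using c by (auto simp: compact_continuous_problems_def)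
  have "(\<lambda>(x, y). (x, \<gamma> y)) \<in> ?XY \<rightarrow>\<^sub>M borel_on X \<Otimes>\<^sub>M borel_on U" using \<gamma> by measurable
  from measurable_compose[OF this cm] have m: "(\<lambda>(x, y). c x (\<gamma> y)) \<in> borel_measurable ?XY"
    by (simp add: case_prod_beta')
  have "expected_cost c \<mu> \<gamma> = (\<integral>x. \<integral>z. (\<lambda>(x, y). c x (\<gamma> y)) z \<partial>distr (Q x) ?XY (Pair x) \<partial>\<zeta>)"
    unfolding expected_cost_def bind(1)
  proof (rule prob_space.integral_bind_bounded[OF \<zeta>(1) m bind(2)])
    show "\<bar>case z of (x, y) \<Rightarrow> c x (\<gamma> y)\<bar> \<le> C" if "z \<in> space ?XY" for z
      using that measurable_space[OF \<gamma>]
      by (cases z) (auto simp: space_pair_measure space_restrict_space intro!: C)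
  qed
  also have "\<dots> = (\<integral>x. \<integral>y. c x (\<gamma> y) \<partial>Q x \<partial>\<zeta>)"
  proof (rule Bochner_Integration.integral_cong[OF refl])
    fix x assume "x \<in> space \<zeta>"
    then have x: "x \<in> space (borel_on X)" using sets_eq_imp_space_eq[OF \<zeta>(2)] by simp
    note Qx = kernel_prob_space[OF Q x]
    have "Pair x \<in> Q x \<rightarrow>\<^sub>M ?XY"
      using measurable_Pair1'[OF x] measurable_cong_sets[OF Qx(2) refl] by blast
    from integral_distr[OF this m]
    show "(\<integral>z. (\<lambda>(x, y). c x (\<gamma> y)) z \<partial>distr (Q x) ?XY (Pair x)) = (\<integral>y. c x (\<gamma> y) \<partial>Q x)" by simp
  qed
  finally show ?thesis .
qed

text \<open>An optimal policy under \<open>\<mu>\<close> may not exist, so the comparison of infima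
  is used up to the slack \<open>\<delta>\<close>. Boundedness of the cost ensures that the infimum
  under \<open>\<nu>\<close> lies below the cost of \<open>s\<close>.\<close>

lemma more_informative_policy:
  fixes X :: "'x::polish_space set" and Y :: "'y::polish_space set" and U :: "'u::polish_space set"
  assumes mi: "more_informative X Y \<mu> \<nu>"
    and \<mu>: "information_structure X Y \<zeta> \<mu>" and \<nu>: "information_structure X Y \<zeta> \<nu>"
    and c: "(c, U) \<in> compact_continuous_problems X" and s: "s \<in> policies Y U" and "0 < \<delta>"
  shows "\<exists>\<gamma>\<in>policies Y U. expected_cost c \<mu> \<gamma> \<le> expected_cost c \<nu> s + \<delta>"
proof -
  obtain C where C: "\<And>x u. x \<in> X \<Longrightarrow> u \<in> U \<Longrightarrow> \<bar>c x u\<bar> \<le> C"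
    and cm: "case_prod c \<in> borel_measurable (borel_on X \<Otimes>\<^sub>M borel_on U)"
    using c by (auto simp: compact_continuous_problems_def)
  interpret \<nu>: prob_space \<nu> using \<nu> by (simp add: information_structure_def)
  have sets: "sets \<mu> = sets (borel_on X \<Otimes>\<^sub>M borel_on Y)" "sets \<nu> = sets (borel_on X \<Otimes>\<^sub>M borel_on Y)"
    using \<mu> \<nu> by (auto simp: information_structure_def)
  have "bdd_below (expected_cost c \<nu> ` policies Y U)"
  proof (rule bdd_belowI2)
    fix \<gamma> assume \<gamma>: "\<gamma> \<in> policies Y U"
    have "(\<lambda>(x, y). (x, \<gamma> y)) \<in> borel_on X \<Otimes>\<^sub>M borel_on Y \<rightarrow>\<^sub>M borel_on X \<Otimes>\<^sub>M borel_on U"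
      using \<gamma> by measurable
    from measurable_compose[OF this cm]
    have "(\<lambda>(x, y). c x (\<gamma> y)) \<in> borel_measurable \<nu>"
      unfolding measurable_cong_sets[OF sets(2) refl] by (simp add: case_prod_beta')
    then have "\<bar>expected_cost c \<nu> \<gamma>\<bar> \<le> C"
      unfolding expected_cost_def
    proof (rule \<nu>.abs_integral_le)
      show "\<bar>case z of (x, y) \<Rightarrow> c x (\<gamma> y)\<bar> \<le> C" if "z \<in> space \<nu>" for z
        using that measurable_space[OF \<gamma>] sets_eq_imp_space_eq[OF sets(2)]
        by (cases z) (auto simp: space_pair_measure space_restrict_space intro!: C)
    qed
    then show "- C \<le> expected_cost c \<nu> \<gamma>" by (simp add: abs_le_iff minus_le_iff)
  qed
  then have "optimal_cost Y c U \<nu> \<le> expected_cost c \<nu> s"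
    unfolding optimal_cost_def using s by (rule cINF_lower)
  moreover have "optimal_cost Y c U \<mu> \<le> optimal_cost Y c U \<nu>"
    using more_informative_universal[OF mi sets] c by (auto simp: more_informative_over_def)
  ultimately have "optimal_cost Y c U \<mu> < expected_cost c \<nu> s + \<delta>" using \<open>0 < \<delta>\<close> by simp
  then show ?thesis
    unfolding optimal_cost_def using s by (auto dest!: cInf_lessD[rotated] intro: less_imp_le)
qed

theorem theorem3p3:
  fixes X :: "'x::polish_space set" and Y :: "'y::polish_space set"
    and \<zeta> :: "'x measure" and \<mu> \<nu> :: "('x \<times> 'y) measure"
    and Q\<mu> Q\<nu> :: "'x \<Rightarrow> 'y measure"
  assumes "X \<in> sets borel" and "Y \<in> sets borel" and "compact Y"
    and "prob_space \<zeta>" and "sets \<zeta> = sets (borel_on X)"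
    and "information_structure X Y \<zeta> \<mu>" and "information_structure X Y \<zeta> \<nu>"
    and "measurement_channel X Y \<zeta> \<mu> Q\<mu>" and "measurement_channel X Y \<zeta> \<nu> Q\<nu>"
    and "absolutely_continuous_channel X Y Q\<mu>" and "absolutely_continuous_channel X Y Q\<nu>"
    and "more_informative X Y \<mu> \<nu>"
  shows "garbling X Y \<zeta> Q\<nu> Q\<mu>"
proof -
  note \<zeta> = assms(4,5)
  interpret \<mu>: prob_space \<mu> using assms(6) by (simp add: information_structure_def)
  have sets: "sets \<mu> = sets (borel_on X \<Otimes>\<^sub>M borel_on Y)"
    using assms(6) by (auto simp: information_structure_def)
  have sp: "space \<zeta> = X" using sets_eq_imp_space_eq[OF \<zeta>(2)] by (simp add: space_restrict_space)
  \<comment> \<open>A probability measure on the product cannot live on the empty set.\<close>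
  have "Y \<noteq> {}"
    using \<mu>.not_empty sets_eq_imp_space_eq[OF sets] by (auto simp: space_pair_measure space_restrict_space)
  then obtain s r where s: "s \<in> borel_on Y \<rightarrow>\<^sub>M borel_on {0..1::real}"
    and r: "r \<in> borel \<rightarrow>\<^sub>M borel_on Y" and rs: "\<And>y. y \<in> Y \<Longrightarrow> r (s y) = y"
    using ex_real_code[OF assms(3)] by blast
  have kernel: "Q \<in> \<zeta> \<rightarrow>\<^sub>M prob_algebra (borel_on Y)" if "measurement_channel X Y \<zeta> \<mu>' Q" for \<mu>' Q
    using that measurable_cong_sets[OF \<zeta>(2) refl]
    by (auto simp: measurement_channel_def stochastic_kernel_def)
  note P = kernel[OF assms(8)] and Q = kernel[OF assms(9)]
  obtain e :: "nat \<Rightarrow> real \<Rightarrow> real" where e: "\<And>j. continuous_on UNIV (e j)" "\<And>j u. e j u \<in> {0..1}"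
    "\<And>a. \<exists>\<sigma>. \<forall>u. (\<lambda>k. e (\<sigma> k) u) \<longlonglongrightarrow> indicator {..a} u"
    using ex_ramp_sequence by blast
  interpret dominating_kernel \<zeta> "borel_on Y" Q\<mu> Q\<nu> s e
  proof (rule dominating_kernel.intro[OF \<zeta>(1)], rule dominating_kernel_axioms.intro)
    fix c :: "'x \<Rightarrow> real \<Rightarrow> real" and \<delta> :: real
    assume cm: "case_prod c \<in> borel_measurable (\<zeta> \<Otimes>\<^sub>M borel)"
      and c1: "\<And>x u. x \<in> space \<zeta> \<Longrightarrow> \<bar>c x u\<bar> \<le> 1"
      and cc: "\<And>x. x \<in> space \<zeta> \<Longrightarrow> continuous_on UNIV (c x)" and \<delta>: "0 < \<delta>"
    \<comment> \<open>The inclusion of the unit interval into the line, used to restrict the cost to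
      the compact action space \<open>{0..1}\<close>.\<close>
    have "(\<lambda>z. (fst z, snd z)) \<in> borel_on X \<Otimes>\<^sub>M borel_on {0..1} \<rightarrow>\<^sub>M \<zeta> \<Otimes>\<^sub>M (borel :: real measure)"
    proof (rule measurable_Pair)
      show "fst \<in> borel_on X \<Otimes>\<^sub>M borel_on {0..1::real} \<rightarrow>\<^sub>M \<zeta>"
        using measurable_fst measurable_cong_sets[OF refl \<zeta>(2)] by blast
      show "snd \<in> borel_on X \<Otimes>\<^sub>M borel_on {0..1::real} \<rightarrow>\<^sub>M borel"
        using measurable_compose[OF measurable_snd measurable_restrict_space1[OF measurable_ident]]
        by (simp add: id_def)
    qed
    from measurable_compose[OF this cm]
    have "case_prod c \<in> borel_measurable (borel_on X \<Otimes>\<^sub>M borel_on {0..1})"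
      by (simp add: case_prod_beta')
    then have cp: "(c, {0..1}) \<in> compact_continuous_problems X"
      using c1 cc by (auto simp: compact_continuous_problems_def sp intro: continuous_on_subset)
    from more_informative_policy[OF assms(12,6,7) cp s \<delta>]
    show "\<exists>\<gamma> \<in> borel_on Y \<rightarrow>\<^sub>M borel_on {0..1}.
        (\<integral>x. \<integral>y. c x (\<gamma> y) \<partial>Q\<mu> x \<partial>\<zeta>) \<le> (\<integral>x. \<integral>y. c x (s y) \<partial>Q\<nu> x \<partial>\<zeta>) + \<delta>"
      using expected_cost_eq_channel[OF assms(8,6) \<zeta> cp]
        expected_cost_eq_channel[OF assms(9,7) \<zeta> cp s] by auto
  qed (use P Q s e in auto)
  obtain K where K: "K \<in> borel_on Y \<rightarrow>\<^sub>M prob_algebra borel"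
    and ae: "AE x in \<zeta>. distr (Q\<nu> x) borel s = Q\<mu> x \<bind> K"
    using ex_garbling by blast
  \<comment> \<open>Decoding the random action by \<open>r\<close> brings the kernel back to
    \<open>Y\<close>.\<close>
  let ?Q' = "\<lambda>y. distr (K y) (borel_on Y) r"
  have "stochastic_kernel Y Y ?Q'"
    unfolding stochastic_kernel_def using measurable_compose[OF K measurable_distr_prob_space[OF r]] .
  moreover have "measure (Q\<nu> x) B = (\<integral>y. measure (?Q' y) B \<partial>Q\<mu> x)"
    if x: "x \<in> space \<zeta>" and eq: "distr (Q\<nu> x) borel s = Q\<mu> x \<bind> K" and B: "B \<in> sets (borel_on Y)" for x B
  proof -
    note Px = kernel_prob_space[OF P x] and Qx = kernel_prob_space[OF Q x]
    interpret Px: prob_space "Q\<mu> x" by (rule Px)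
    have sm: "s \<in> borel_measurable (Q\<nu> x)"
      using policy_meas[OF s] measurable_cong_sets[OF Qx(2) refl] by blast
    have rB: "r -` B \<in> sets borel" using measurable_sets[OF r B] by simp
    have KP: "K \<in> Q\<mu> x \<rightarrow>\<^sub>M subprob_algebra borel"
      using measurable_prob_algebraD[OF K] measurable_cong_sets[OF Px(2) refl] by blast
    \<comment> \<open>Because \<open>r\<close> inverts \<open>s\<close> on \<open>Y\<close>,
      encoding and decoding loses no event, and the identity on the line carries over to
      \<open>B\<close>.\<close>
    have "B = s -` (r -` B) \<inter> space (Q\<nu> x)"
      using sets.sets_into_space[OF B] rs by (auto simp: Qx(3) space_restrict_space)
    then have "measure (Q\<nu> x) B = measure (distr (Q\<nu> x) borel s) (r -` B)"
      using sm rB by (simp add: measure_distr)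
    also have "\<dots> = (\<integral>y. measure (K y) (r -` B) \<partial>Q\<mu> x)"
      unfolding eq by (rule Px.measure_bind[OF KP rB])
    also have "\<dots> = (\<integral>y. measure (?Q' y) B \<partial>Q\<mu> x)"
    proof (rule Bochner_Integration.integral_cong[OF refl])
      fix y assume "y \<in> space (Q\<mu> x)"
      then have y: "y \<in> space (borel_on Y)" by (simp add: Px(3))
      note Ky = kernel_prob_space[OF K y]
      have "r \<in> K y \<rightarrow>\<^sub>M borel_on Y" using r measurable_cong_sets[OF Ky(2) refl] by blast
      then show "measure (K y) (r -` B) = measure (?Q' y) B"
        using B Ky(3) by (simp add: measure_distr)
    qed
    finally show ?thesis .
  qed
  then have "AE x in \<zeta>. \<forall>B\<in>sets (borel_on Y). measure (Q\<nu> x) B = (\<integral>y. measure (?Q' y) B \<partial>Q\<mu> x)"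
    using ae AE_space by (auto elim!: AE_mp)
  ultimately show ?thesis unfolding garbling_def by blast
qed

end
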